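(* For integers $r\ge1$ let $\kappa_n^{(r)}$ be the $r$-th order cumulant of the random variable $f_0(T_n)$. Then $$\kappa_n^{(r)}=\mu^{(r)}(0)\,(\log n)\,(1+o(1))$$ as $n\to\infty$, where $\mu^{(r)}(0)$ is the $r$-th derivative at $t=0$ of $$\mu(t):=\frac{\sqrt{8e^t+1}-1}{2}-1.$$
   Context: Let $T\subset\mathbb{R}^2$ be the triangle with vertices $(0,0)$, $\mathbf{v}_1=(1,0)$, $\mathbf{v}_2=(0,1)$. For $n\ge 0$ let $\mathbf{X}_1,\dots,\mathbf{X}_n$ be independent uniformly distributed random points in $T$ and $T_n:=\operatorname{conv}\{\mathbf{v}_1,\mathbf{v}_2,\mathbf{X}_1,\dots,\mathbf{X}_n\}$. $f_0(T_n)$ is the number of vertices of $T_n$ (including $\mathbf{v}_1,\mathbf{v}_2$). The $r$-th order cumulant of a random variable $X$ whose moment generating function is finite near $0$ is $\frac{d^r}{dt^r}\log\mathbb{E}e^{tX}\big|_{t=0}$. *)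

theory Defs
  imports "HOL-Probability.Probability" "HOL-Library.Landau_Symbols"
begin

definition v1 :: "real \<times> real" where "v1 = (1, 0)"

definition v2 :: "real \<times> real" where "v2 = (0, 1)"

definition T :: "(real \<times> real) set" where
  "T = convex hull {(0, 0), v1, v2}"

definition Tn :: "nat \<Rightarrow> (nat \<Rightarrow> 'a \<Rightarrow> real \<times> real) \<Rightarrow> 'a \<Rightarrow> (real \<times> real) set" where
  "Tn n X \<omega> = convex hull ({v1, v2} \<union> (\<lambda>i. X i \<omega>) ` {1..n})"

definition f0 :: "(real \<times> real) set \<Rightarrow> nat" where
  "f0 P = card {x. x extreme_point_of P}"

(* Meaningful for a random variable whose moment generating function is finite near 0. *)
definition cumulant :: "'a measure \<Rightarrow> ('a \<Rightarrow> real) \<Rightarrow> nat \<Rightarrow> real" where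
  "cumulant M Y r = (deriv ^^ r) (\<lambda>t. ln (\<integral>\<omega>. exp (t * Y \<omega>) \<partial>M)) 0"

definition \<mu> :: "real \<Rightarrow> real" where
  "\<mu> t = (sqrt (8 * exp t + 1) - 1) / 2 - 1"

end

theory Submission
  imports Defs "HOL-Complex_Analysis.Complex_Analysis"
begin

text \<open>
  Follow the boundary of the polygon from \<open>v1\<close>. The first vertex after \<open>v1\<close> is the sample point
  \<open>Y = (1 - u, u q)\<close> of smallest slope \<open>q\<close> as seen from \<open>v1\<close>. All other points lie above the line from
  \<open>v1\<close> to \<open>Y\<close>. Those on the near side of the segment from \<open>Y\<close> to \<open>v2\<close> lie in the triangle
  \<open>v1 Y v2\<close> and are never vertices; those beyond it lie in a corner of relative area \<open>(1 - u) (1 - q)\<close>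
  which an affine map takes to \<open>T\<close>, with \<open>Y\<close> going to \<open>v1\<close> and \<open>v2\<close> fixed
  (\<open>f0_hull_first_vertex\<close>). So the rest of the boundary is a copy of the same random object with fewer
  points. Integrating over \<open>Y\<close> shows that \<open>z\<^sup>2 G\<^sub>n(z)\<close> is the probability generating function of the number
  of vertices, where \<open>G\<^sub>0 = 1\<close> and \<open>n (n + 1) G\<^sub>n = 2 z (\<Sum>k<n. (n - k) G\<^sub>k)\<close>
  (\<open>vertex_pgf_eq_chain_gf\<close>).

  For the power series \<open>F = (\<Sum>n. G\<^sub>n x\<^sup>n)\<close> this is the equation \<open>(1 - x)\<^sup>2 (x F)'' = 2 z F\<close>. With
  \<open>2 z = a (a + 1)\<close> its solution is \<open>(1 - x) powr (- a)\<close> times a hypergeometric series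
  (\<open>chain_gf_eq_convolution\<close>). For \<open>z = exp t\<close> one has \<open>a = 1 + \<mu> t\<close>. The hypergeometric factor is
  \<open>1\<close> at \<open>a = 1\<close>, and for complex \<open>a\<close> within \<open>1 / 4\<close> of \<open>1\<close> it changes the coefficients
  \<open>(\<Prod>j=1..n. 1 + \<mu> t / j)\<close> of the first factor by a relative error of at most \<open>5 / 12\<close>, for every \<open>n\<close>
  (\<open>chain_gf_near_binom_coeff\<close>). Therefore the logarithm of the moment generating function, minus
  \<open>\<mu> t\<close> times the harmonic number \<open>harm n\<close>, is holomorphic and bounded on a disc around \<open>0\<close> that does not
  depend on \<open>n\<close>. By Cauchy's inequality its derivatives at \<open>0\<close> are bounded, so the cumulant of order
  \<open>r\<close> differs from \<open>harm n\<close> times the \<open>r\<close>-th derivative of \<open>\<mu>\<close> at \<open>0\<close> by a bounded amount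
  (\<open>higher_deriv_log_chain_gf_bound\<close>).

  To turn this additive error into the relative error of the theorem, the \<open>r\<close>-th derivative of \<open>\<mu>\<close> at
  \<open>0\<close> must not vanish. It equals \<open>2 (1 + 4 m) / 3^(2 r - 1)\<close> with an integer \<open>m\<close>
  (\<open>higher_deriv_mu_0_nonzero\<close>).
\<close>

section \<open>Vertices of the hull seen from the first vertex\<close>

lemma extreme_point_of_convex_hull_iff:
  assumes "finite S"
  shows "x extreme_point_of (convex hull S) \<longleftrightarrow> x \<in> S \<and> x \<notin> convex hull (S - {x})"
proof
  assume ext: "x extreme_point_of (convex hull S)"
  then have "x \<in> S" by (rule extreme_point_of_convex_hull)
  moreover have "x \<notin> convex hull (S - {x})"
  proof
    assume "x \<in> convex hull (S - {x})"
    then have "convex hull S = convex hull (S - {x})"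
      using hull_redundant[of x convex "S - {x}"] \<open>x \<in> S\<close> by (simp add: insert_absorb)
    then show False using ext extreme_point_of_convex_hull[of x "S - {x}"] by simp
  qed
  ultimately show "x \<in> S \<and> x \<notin> convex hull (S - {x})" ..
next
  assume "x \<in> S \<and> x \<notin> convex hull (S - {x})"
  then show "x extreme_point_of (convex hull S)"
    using extreme_point_of_convex_hull_insert[of "S - {x}" x] assms
    by (simp add: insert_absorb)
qed

lemma f0_eq_card:
  assumes "finite S"
  shows "f0 (convex hull S) = card {x \<in> S. x \<notin> convex hull (S - {x})}"
  unfolding f0_def extreme_point_of_convex_hull_iff[OF assms] by simp

lemma f0_affine_image:
  fixes f :: "real \<times> real \<Rightarrow> real \<times> real"
  assumes "linear f" "inj f"
  shows "f0 ((\<lambda>x. c + f x) ` P) = f0 P"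
proof -
  have inj: "inj (\<lambda>x. c + f x)" using \<open>inj f\<close> by (simp add: inj_def)
  have seg: "open_segment (c + f a) (c + f b) = (\<lambda>x. c + f x) ` open_segment a b" for a b
    using open_segment_linear_image[OF assms, of a b] open_segment_translation[of c "f a" "f b"]
    by (simp add: image_image)
  have mem: "(c + f x) \<in> (\<lambda>x. c + f x) ` A \<longleftrightarrow> x \<in> A" for x A
    using inj_image_mem_iff[OF inj, of x A] by simp
  have ext: "(c + f x) extreme_point_of ((\<lambda>x. c + f x) ` P) \<longleftrightarrow> x extreme_point_of P" for x
    by (simp add: extreme_point_of_def seg mem)
  have "{x. x extreme_point_of ((\<lambda>x. c + f x) ` P)} = (\<lambda>x. c + f x) ` {x. x extreme_point_of P}"
    using ext by (blast dest: extreme_point_of_def[THEN iffD1])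
  then show ?thesis
    unfolding f0_def using inj by (metis card_image inj_on_subset subset_UNIV)
qed

lemma T_eq: "T = {p. 0 \<le> fst p \<and> 0 \<le> snd p \<and> fst p + snd p \<le> 1}"
proof -
  have "p \<in> T \<longleftrightarrow> 0 \<le> fst p \<and> 0 \<le> snd p \<and> fst p + snd p \<le> 1" for p
  proof -
    have "p \<in> T \<longleftrightarrow> (\<exists>u v w. 0 \<le> u \<and> 0 \<le> v \<and> 0 \<le> w \<and> u + v + w = 1 \<and> p = (v, w))"
      unfolding T_def convex_hull_3 by (auto simp: v1_def v2_def)
    also have "\<dots> \<longleftrightarrow> 0 \<le> fst p \<and> 0 \<le> snd p \<and> fst p + snd p \<le> 1"
    proof
      assume "0 \<le> fst p \<and> 0 \<le> snd p \<and> fst p + snd p \<le> 1"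
      then show "\<exists>u v w. 0 \<le> u \<and> 0 \<le> v \<and> 0 \<le> w \<and> u + v + w = 1 \<and> p = (v, w)"
        by (intro exI[of _ "1 - fst p - snd p"] exI[of _ "fst p"] exI[of _ "snd p"]) auto
    qed auto
    finally show ?thesis .
  qed
  then show ?thesis by blast
qed

lemma convex_T: "convex T" unfolding T_def by (rule convex_convex_hull)

lemma v12_in_T: "v1 \<in> T" "v2 \<in> T" by (auto simp: T_eq v1_def v2_def)

text \<open>After the affine map that takes the first vertex to \<open>v1\<close>, the point that was \<open>v1\<close> before lies
  beyond it on the first axis, at \<open>(w, 0)\<close>. Points of \<open>S\<close> outside \<open>T\<close> lie in the triangle spanned by
  \<open>(w, 0)\<close>, \<open>v1\<close> and \<open>v2\<close> and so never are vertices. Conversely no vertex of the smaller hull is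
  lost: if such a vertex were a combination of \<open>(w, 0)\<close> and a point \<open>k\<close> of the smaller hull, the
  segment between these two would enter the smaller hull through the edge from \<open>v1\<close> to \<open>v2\<close>, and
  the vertex would lie on that edge or strictly inside a segment of the smaller hull.\<close>
lemma f0_hull_insert_beyond:
  fixes w :: real and S :: "(real \<times> real) set"
  assumes "1 < w" "finite S"
    and S: "\<And>p. p \<in> S \<Longrightarrow> 0 \<le> fst p \<and> 0 < snd p \<and> fst p / w + snd p \<le> 1"
  shows "f0 (convex hull (insert (w, 0) ({v1, v2} \<union> S)))
       = Suc (f0 (convex hull ({v1, v2} \<union> (S \<inter> T))))"
proof -
  define a where "a = (w, 0 :: real)"
  define B where "B = {v1, v2} \<union> (S \<inter> T)"
  define K where "K = convex hull B"
  \<comment> \<open>\<open>L = 1\<close> is the line through \<open>v1\<close> and \<open>v2\<close>; it separates \<open>a\<close> from \<open>K\<close>.\<close>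
  define L where "L = (\<lambda>p :: real \<times> real. fst p + snd p)"
  have "v1 \<noteq> v2" by (simp add: v1_def v2_def)
  have finB: "finite B" using \<open>finite S\<close> by (simp add: B_def)
  have BT: "B \<subseteq> T" using v12_in_T by (auto simp: B_def)
  have KT: "K \<subseteq> T" unfolding K_def using BT convex_T by (rule hull_minimal)
  have aT: "a \<notin> T" using \<open>1 < w\<close> by (simp add: a_def T_eq)
  have aK: "a \<notin> K" using aT KT by blast
  have v1K: "v1 \<in> K" and v2K: "v2 \<in> K"
    unfolding K_def B_def by (auto intro: hull_inc)
  have hull3: "p \<in> convex hull {a, v1, v2}" if "p \<in> S" "p \<notin> T" for p
  proof -
    obtain x y where p: "p = (x, y)" by (cases p)
    have xy: "0 \<le> x" "0 < y" "x + y > 1" "x \<le> w * (1 - y)"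
      using S[OF \<open>p \<in> S\<close>] \<open>p \<notin> T\<close> \<open>1 < w\<close> by (auto simp: p T_eq field_simps)
    \<comment> \<open>the barycentric coordinate of \<open>p\<close> at the vertex \<open>a\<close>\<close>
    define \<alpha> where "\<alpha> = (x + y - 1) / (w - 1)"
    have \<alpha>: "\<alpha> * (w - 1) = x + y - 1" using \<open>1 < w\<close> by (simp add: \<alpha>_def)
    have "\<alpha> \<ge> 0" using xy \<open>1 < w\<close> by (simp add: \<alpha>_def)
    moreover have "\<alpha> \<le> 1 - y" using xy \<open>1 < w\<close> by (simp add: \<alpha>_def field_simps)
    ultimately show ?thesis
      unfolding convex_hull_3 using xy \<alpha>
      by (intro CollectI exI[of _ \<alpha>] exI[of _ "1 - y - \<alpha>"] exI[of _ y])
         (auto simp: p a_def v1_def v2_def algebra_simps)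
  qed
  have hull: "convex hull (insert (w, 0) ({v1, v2} \<union> S)) = convex hull (insert a B)"
  proof
    have "insert (w, 0) ({v1, v2} \<union> S) \<subseteq> convex hull (insert a B)"
    proof
      fix p assume "p \<in> insert (w, 0) ({v1, v2} \<union> S)"
      then consider "p \<in> insert a B" | "p \<in> S" "p \<notin> T" by (auto simp: a_def B_def)
      then show "p \<in> convex hull (insert a B)"
      proof cases
        case 2
        have "convex hull {a, v1, v2} \<subseteq> convex hull (insert a B)"
          by (rule hull_mono) (auto simp: B_def)
        then show ?thesis using hull3[OF 2] by blast
      qed (rule hull_inc)
    qed
    then show "convex hull (insert (w, 0) ({v1, v2} \<union> S)) \<subseteq> convex hull (insert a B)"
      by (rule hull_minimal) (rule convex_convex_hull)
    show "convex hull (insert a B) \<subseteq> convex hull (insert (w, 0) ({v1, v2} \<union> S))"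
      by (rule hull_mono) (auto simp: B_def a_def)
  qed
  have keep: "x \<notin> convex hull (insert a B - {x})" if xB: "x \<in> B" and x: "x extreme_point_of K" for x
  proof
    have x': "x \<notin> convex hull (B - {x})"
      using x extreme_point_of_convex_hull_iff[OF finB] by (simp add: K_def)
    have "x \<noteq> a" using xB BT aT by blast
    have ne: "B - {x} \<noteq> {}" using \<open>v1 \<noteq> v2\<close> by (auto simp: B_def)
    assume "x \<in> convex hull (insert a B - {x})"
    also have "insert a B - {x} = insert a (B - {x})" using \<open>x \<noteq> a\<close> by blast
    finally obtain s t k where st: "0 \<le> s" "0 \<le> t" "s + t = 1" and k: "k \<in> convex hull (B - {x})"
      and xe: "x = s *\<^sub>R a + t *\<^sub>R k"
      unfolding convex_hull_insert[OF ne] by blast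
    have t_eq: "t = 1 - s" using st(3) by simp
    have kK: "k \<in> K" using k hull_mono[of "B - {x}" B] by (auto simp: K_def)
    then have kT: "k \<in> T" using KT by blast
    have s0: "s > 0" using st x' k xe by (cases "s = 0") auto
    have x1: "fst x = s * w + t * fst k" and x2: "snd x = t * snd k"
      by (auto simp: xe a_def)
    have xT: "x \<in> T" using xB BT by blast
    have Lx: "L x = s * w + t * L k" by (simp add: L_def x1 x2 algebra_simps)
    have "L x \<le> 1" "L k \<le> 1" using xT kT by (auto simp: L_def T_eq)
    have "L k < 1"
    proof (rule ccontr)
      assume "\<not> L k < 1"
      then have "L k = 1" using \<open>L k \<le> 1\<close> by simp
      then have "L x = 1 + s * (w - 1)" using Lx t_eq by (simp add: algebra_simps)
      then show False using \<open>L x \<le> 1\<close> s0 \<open>1 < w\<close> mult_pos_pos[of s "w - 1"] by linarith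
    qed
    \<comment> \<open>\<open>m\<close> is the point where the segment from \<open>a\<close> to \<open>k\<close> crosses the line \<open>L = 1\<close>.\<close>
    define \<tau> where "\<tau> = (w - 1) / (w - L k)"
    have \<tau>: "0 < \<tau>" "\<tau> < 1" using \<open>1 < w\<close> \<open>L k < 1\<close> by (auto simp: \<tau>_def)
    have \<tau>eq: "w - \<tau> * (w - L k) = 1" using \<open>1 < w\<close> \<open>L k < 1\<close> by (simp add: \<tau>_def)
    define m where "m = (1 - \<tau>) *\<^sub>R a + \<tau> *\<^sub>R k"
    have m1: "fst m = (1 - \<tau>) * w + \<tau> * fst k" and m2: "snd m = \<tau> * snd k"
      by (auto simp: m_def a_def)
    have mL: "fst m + snd m = 1" using \<tau>eq by (simp add: m1 m2 L_def algebra_simps)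
    have mpos: "0 \<le> fst m" "0 \<le> snd m" using \<tau> kT \<open>1 < w\<close> by (auto simp: m1 m2 T_eq)
    have mseg: "m = fst m *\<^sub>R v1 + snd m *\<^sub>R v2" by (simp add: v1_def v2_def)
    have mK: "m \<in> K"
      using v1K v2K mL mpos convex_convex_hull[of B] unfolding K_def
      by (subst mseg) (rule convexD, auto)
    have "t \<ge> \<tau>"
    proof (rule ccontr)
      assume "\<not> \<tau> \<le> t"
      then have "t * (w - L k) < \<tau> * (w - L k)" using \<open>1 < w\<close> \<open>L k < 1\<close> by simp
      moreover have "L x = w - t * (w - L k)" unfolding Lx t_eq by (simp add: algebra_simps)
      ultimately show False using \<tau>eq \<open>L x \<le> 1\<close> by linarith
    qed
    have t1: "t < 1" using st s0 by simp
    show False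
    proof (cases "t = \<tau>")
      case True
      then have xm: "x = m" using st by (simp add: xe m_def eq_diff_eq)
      have "x = v1 \<or> x = v2"
      proof (rule ccontr)
        assume "\<not> (x = v1 \<or> x = v2)"
        moreover have "x \<in> closed_segment v1 v2"
          unfolding closed_segment_def using mL mpos mseg
          by (intro CollectI exI[of _ "snd m"]) (auto simp: xm eq_diff_eq[symmetric])
        ultimately have "x \<in> open_segment v1 v2" by (simp add: open_segment_def)
        then show False using x v1K v2K by (auto simp: extreme_point_of_def)
      qed
      moreover have "x \<noteq> v1"
      proof
        assume "x = v1"
        have "B - {x} \<subseteq> {p. snd p > 0}"
          using S by (auto simp: B_def \<open>x = v1\<close> v2_def)
        moreover have "convex {p :: real \<times> real. snd p > 0}"
          using convex_halfspace_gt[of 0 "(0, 1) :: real \<times> real"] by (simp add: inner_prod_def)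
        ultimately have "snd k > 0" using k hull_minimal[of "B - {x}" "{p. snd p > 0}" convex] by blast
        then show False using x2 \<tau> True \<open>x = v1\<close> by (simp add: v1_def)
      qed
      moreover have "x \<noteq> v2"
      proof
        assume "x = v2"
        then have "0 = s * w + t * fst k" using x1 by (simp add: v2_def)
        moreover have "t * fst k \<ge> 0" using kT st by (simp add: T_eq)
        moreover have "s * w > 0" using s0 \<open>1 < w\<close> by simp
        ultimately show False by linarith
      qed
      ultimately show False by blast
    next
      case False
      then have "\<tau> < t" using \<open>\<tau> \<le> t\<close> by simp
      define \<sigma> where "\<sigma> = (t - \<tau>) / (1 - \<tau>)"
      have \<sigma>: "0 < \<sigma>" "\<sigma> < 1" using \<open>\<tau> < t\<close> t1 \<tau> by (auto simp: \<sigma>_def)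
      have e1: "(1 - \<sigma>) * (1 - \<tau>) = s"
      proof -
        have "\<sigma> * (1 - \<tau>) = t - \<tau>" using \<tau> by (simp add: \<sigma>_def)
        then show ?thesis using st(3) by (simp add: algebra_simps)
      qed
      have e2: "(1 - \<sigma>) * \<tau> + \<sigma> = t" using e1 st(3) by (simp add: algebra_simps)
      have "x = (1 - \<sigma>) *\<^sub>R m + \<sigma> *\<^sub>R k"
        unfolding m_def scaleR_add_right scaleR_scaleR e1 add.assoc scaleR_left_distrib[symmetric] e2 xe ..
      moreover have "m \<noteq> k" using mL \<open>L k < 1\<close> by (auto simp: L_def)
      ultimately have "x \<in> open_segment m k" using \<sigma> by (auto simp: in_segment)
      then show False using x mK kK by (auto simp: extreme_point_of_def)
    qed
  qed
  have "{x \<in> insert a B. x \<notin> convex hull (insert a B - {x})}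
      = insert a {x. x extreme_point_of K}"
  proof (intro equalityI subsetI)
    fix x assume "x \<in> {x \<in> insert a B. x \<notin> convex hull (insert a B - {x})}"
    then have "x \<in> insert a B" and x: "x \<notin> convex hull (insert a B - {x})" by auto
    have "x \<notin> convex hull (B - {x})"
      using x hull_mono[of "B - {x}" "insert a B - {x}" convex] by blast
    then show "x \<in> insert a {x. x extreme_point_of K}"
      using \<open>x \<in> insert a B\<close> unfolding K_def by (auto simp: extreme_point_of_convex_hull_iff[OF finB])
  next
    fix x assume "x \<in> insert a {x. x extreme_point_of K}"
    moreover have "a \<notin> convex hull (insert a B - {a})"
    proof -
      have "insert a B - {a} = B" using aT BT by blast
      then show ?thesis using aK by (simp add: K_def)
    qed
    moreover have "x \<in> B" if "x extreme_point_of K"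
      using that by (simp add: K_def extreme_point_of_convex_hull)
    ultimately show "x \<in> {x \<in> insert a B. x \<notin> convex hull (insert a B - {x})}"
      using keep by blast
  qed
  moreover have "a \<notin> {x. x extreme_point_of K}" using aK by (auto simp: extreme_point_of_def)
  moreover have "finite {x. x extreme_point_of K}"
    using finB finite_subset[OF extreme_points_of_convex_hull] unfolding K_def by blast
  ultimately show ?thesis
    unfolding hull f0_eq_card[OF finite.insertI[OF finB]] by (simp add: f0_def K_def B_def)
qed

text \<open>The affine map that takes the first vertex \<open>(1 - u, u * q)\<close> to \<open>v1\<close>, the point \<open>(0, q)\<close> to the
  origin and \<open>v2\<close> to itself.\<close>
definition renorm :: "real \<Rightarrow> real \<Rightarrow> real \<times> real \<Rightarrow> real \<times> real" where
  "renorm u q p = (fst p / (1 - u), (snd p - q * (1 - fst p)) / (1 - q))"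

text \<open>The open half-plane above the line through \<open>v1\<close> and \<open>(0, q)\<close>.\<close>
definition above :: "real \<Rightarrow> (real \<times> real) set" where
  "above q = {p. q * (1 - fst p) < snd p}"

text \<open>If all other points lie strictly above the line from \<open>v1\<close> through \<open>Y = (1 - u, u * q)\<close>, then \<open>Y\<close>
  is the neighbour of \<open>v1\<close> on the hull, and the rest of the boundary is, up to the affine map
  \<open>renorm\<close>, the boundary of a polygon of the same kind. This makes the problem self-similar.\<close>
lemma f0_hull_first_vertex:
  assumes u: "0 < u" "u < 1" and q: "0 < q" "q < 1"
    and S: "finite S" "S \<subseteq> T \<inter> above q"
  shows "f0 (convex hull ({v1, v2} \<union> insert (1 - u, u * q) S))
       = Suc (f0 (convex hull ({v1, v2} \<union> (renorm u q ` S \<inter> T))))"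
proof -
  define f where "f = (\<lambda>p :: real \<times> real. (fst p / (1 - u), (snd p + q * fst p) / (1 - q)))"
  define c where "c = (0 :: real, - q / (1 - q))"
  have ren: "renorm u q = (\<lambda>p. c + f p)"
    by (auto simp: fun_eq_iff renorm_def c_def f_def algebra_simps simp flip: add_divide_distrib diff_divide_distrib)
  have lin: "linear f"
    by (rule linearI) (auto simp: f_def field_simps add_divide_distrib)
  have inj: "inj f" using u q by (auto simp: inj_def f_def)
  define A where "A = {v1, v2} \<union> insert (1 - u, u * q) S"
  have "convex hull (renorm u q ` A) = renorm u q ` (convex hull A)"
    using convex_hull_translation[of c "f ` A"]
    by (simp add: ren image_image convex_hull_linear_image[OF lin, symmetric])
  then have "f0 (convex hull A) = f0 (convex hull (renorm u q ` A))"
    using f0_affine_image[OF lin inj] by (simp add: ren)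
  also have "renorm u q ` A = insert (1 / (1 - u), 0) ({v1, v2} \<union> renorm u q ` S)"
  proof -
    have "renorm u q v1 = (1 / (1 - u), 0)" by (simp add: renorm_def v1_def)
    moreover have "renorm u q v2 = v2" using q by (simp add: renorm_def v2_def)
    moreover have "renorm u q (1 - u, u * q) = v1" using u by (simp add: renorm_def v1_def)
    ultimately show ?thesis by (auto simp: A_def)
  qed
  also have "f0 (convex hull (insert (1 / (1 - u), 0) ({v1, v2} \<union> renorm u q ` S)))
      = Suc (f0 (convex hull ({v1, v2} \<union> (renorm u q ` S \<inter> T))))"
  proof (rule f0_hull_insert_beyond)
    show "1 < 1 / (1 - u)" using u by simp
    show "finite (renorm u q ` S)" using S by simp
    fix p assume "p \<in> renorm u q ` S"
    then obtain a b where p: "p = renorm u q (a, b)" and "(a, b) \<in> S" by auto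
    then have ab: "0 \<le> a" "q * (1 - a) < b" "a + b \<le> 1" using S by (auto simp: T_eq above_def)
    have "a + (b - q * (1 - a)) / (1 - q) \<le> 1"
      using ab q by (simp add: field_simps)
    then show "0 \<le> fst p \<and> 0 < snd p \<and> fst p / (1 / (1 - u)) + snd p \<le> 1"
      using ab u q by (auto simp: p renorm_def)
  qed
  finally show ?thesis by (simp add: A_def)
qed

section \<open>Measurability of the number of vertices\<close>

text \<open>A strictly separating direction for finitely many points can be perturbed, so it may be taken from a
  countable dense set. Membership in a hull thus becomes a countable combination of linear
  inequalities, which is what measurability needs.\<close>
lemma countable_separating_directions:
  obtains D :: "'a :: euclidean_space set" where "countable D"
    "\<And>S x. finite S \<Longrightarrow> x \<notin> convex hull S \<longleftrightarrow> (\<exists>d\<in>D. \<forall>p\<in>S. d \<bullet> p < d \<bullet> x)"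
proof -
  obtain D :: "'a set" where D: "countable D" "\<And>X. open X \<Longrightarrow> X \<noteq> {} \<Longrightarrow> \<exists>d\<in>D. d \<in> X"
    by (rule countable_dense_setE) auto
  have "x \<notin> convex hull S \<longleftrightarrow> (\<exists>d\<in>D. \<forall>p\<in>S. d \<bullet> p < d \<bullet> x)" if "finite S" for S x
  proof
    assume x: "x \<notin> convex hull S"
    obtain a b where ab: "a \<bullet> x < b" "\<forall>p\<in>convex hull S. b < a \<bullet> p"
      using separating_hyperplane_closed_point[OF convex_convex_hull _ x]
        finite_imp_compact_convex_hull[OF \<open>finite S\<close>] compact_imp_closed by blast
    define X where "X = (\<Inter>p\<in>S. {d. d \<bullet> p < d \<bullet> x})"
    have "open X"
      unfolding X_def using \<open>finite S\<close>
      by (intro open_INT) (auto intro!: open_Collect_less continuous_intros)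
    moreover have "- a \<in> X"
      unfolding X_def using ab hull_subset[of S convex] by force
    ultimately obtain d where "d \<in> D" "d \<in> X" using D(2) by blast
    then show "\<exists>d\<in>D. \<forall>p\<in>S. d \<bullet> p < d \<bullet> x" by (auto simp: X_def)
  next
    assume "\<exists>d\<in>D. \<forall>p\<in>S. d \<bullet> p < d \<bullet> x"
    then obtain d where "\<forall>p\<in>S. d \<bullet> p < d \<bullet> x" by blast
    then have "convex hull S \<subseteq> {p. d \<bullet> p < d \<bullet> x}"
      by (intro hull_minimal convex_halfspace_lt) auto
    then show "x \<notin> convex hull S" by auto
  qed
  then show ?thesis using that D(1) by blast
qed

text \<open>Each value is counted at the smallest index at which it occurs, so coinciding points cause no
  double counting.\<close>
lemma card_Collect_image_eq_sum:
  fixes f :: "nat \<Rightarrow> 'b"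
  assumes "finite J"
  shows "card {x \<in> f ` J. P x} = (\<Sum>j\<in>J. if (\<forall>i\<in>J. i < j \<longrightarrow> f i \<noteq> f j) \<and> P (f j) then 1 else 0)"
proof -
  define A where "A = {j \<in> J. (\<forall>i\<in>J. i < j \<longrightarrow> f i \<noteq> f j) \<and> P (f j)}"
  have "inj_on f A" by (auto simp: inj_on_def A_def) (metis linorder_neqE_nat)
  moreover have "f ` A = {x \<in> f ` J. P x}"
  proof (intro equalityI subsetI)
    fix x assume x: "x \<in> {x \<in> f ` J. P x}"
    define j where "j = (LEAST j. j \<in> J \<and> f j = x)"
    have j: "j \<in> J \<and> f j = x" unfolding j_def by (rule LeastI_ex) (use x in auto)
    have "\<forall>i\<in>J. i < j \<longrightarrow> f i \<noteq> f j"
      using not_less_Least[of _ "\<lambda>j. j \<in> J \<and> f j = x"] j unfolding j_def[symmetric] by auto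
    then show "x \<in> f ` A" using j x by (auto simp: A_def)
  qed (auto simp: A_def)
  ultimately have "card {x \<in> f ` J. P x} = card A" by (metis card_image)
  also have "\<dots> = (\<Sum>j\<in>J. if (\<forall>i\<in>J. i < j \<longrightarrow> f i \<noteq> f j) \<and> P (f j) then 1 else 0)"
    unfolding A_def card_eq_sum using \<open>finite J\<close> by (rule sum.inter_filter)
  finally show ?thesis .
qed

lemma measurable_f0_hull_image:
  fixes f :: "nat \<Rightarrow> 'a \<Rightarrow> real \<times> real"
  assumes "finite J" and [measurable]: "\<And>j. j \<in> J \<Longrightarrow> f j \<in> borel_measurable M"
  shows "(\<lambda>\<omega>. real (f0 (convex hull ((\<lambda>j. f j \<omega>) ` J)))) \<in> borel_measurable M"
proof -
  obtain D :: "(real \<times> real) set" where D: "countable D"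
    "\<And>S x. finite S \<Longrightarrow> x \<notin> convex hull S \<longleftrightarrow> (\<exists>d\<in>D. \<forall>p\<in>S. d \<bullet> p < d \<bullet> x)"
    by (rule countable_separating_directions) blast
  note [measurable] = D(1)
  have "real (f0 (convex hull ((\<lambda>j. f j \<omega>) ` J)))
     = (\<Sum>j\<in>J. if (\<forall>i\<in>J. i < j \<longrightarrow> f i \<omega> \<noteq> f j \<omega>) \<and>
          (\<exists>d\<in>D. \<forall>i\<in>J. f i \<omega> \<noteq> f j \<omega> \<longrightarrow> d \<bullet> f i \<omega> < d \<bullet> f j \<omega>) then 1 else 0)" for \<omega>
  proof -
    have fin: "finite ((\<lambda>j. f j \<omega>) ` J)" "finite ((\<lambda>j. f j \<omega>) ` J - {x})" for x
      using \<open>finite J\<close> by auto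
    have *: "(\<forall>p\<in>(\<lambda>j. f j \<omega>) ` J - {x}. d \<bullet> p < d \<bullet> x) \<longleftrightarrow>
        (\<forall>i\<in>J. f i \<omega> \<noteq> x \<longrightarrow> d \<bullet> f i \<omega> < d \<bullet> x)" for d x by blast
    show ?thesis
      unfolding f0_eq_card[OF fin(1)] D(2)[OF fin(2)] * card_Collect_image_eq_sum[OF \<open>finite J\<close>]
      unfolding of_nat_sum by (intro sum.cong) auto
  qed
  moreover have "(\<lambda>\<omega>. \<Sum>j\<in>J. if (\<forall>i\<in>J. i < j \<longrightarrow> f i \<omega> \<noteq> f j \<omega>) \<and>
          (\<exists>d\<in>D. \<forall>i\<in>J. f i \<omega> \<noteq> f j \<omega> \<longrightarrow> d \<bullet> f i \<omega> < d \<bullet> f j \<omega>) then 1 else 0 :: real) \<in> borel_measurable M"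
    using \<open>finite J\<close> countable_finite[OF \<open>finite J\<close>] by measurable
  ultimately show ?thesis by simp
qed

lemma measurable_f0_hull:
  fixes f :: "nat \<Rightarrow> 'a \<Rightarrow> real \<times> real"
  assumes "finite I" and [measurable]: "\<And>i. i \<in> I \<Longrightarrow> f i \<in> borel_measurable M"
  shows "(\<lambda>\<omega>. real (f0 (convex hull ({v1, v2} \<union> (\<lambda>i. f i \<omega>) ` I)))) \<in> borel_measurable M"
proof -
  \<comment> \<open>the fixed points \<open>v1\<close> and \<open>v2\<close> take the first two indices\<close>
  define g where "g j = (case j of 0 \<Rightarrow> (\<lambda>_. v1) | Suc 0 \<Rightarrow> (\<lambda>_. v2) | Suc (Suc i) \<Rightarrow> f i)" for j
  define J where "J = {0, 1} \<union> (Suc \<circ> Suc) ` I"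
  have "(\<lambda>\<omega>. real (f0 (convex hull ((\<lambda>j. g j \<omega>) ` J)))) \<in> borel_measurable M"
    using assms by (intro measurable_f0_hull_image) (auto simp: J_def g_def)
  moreover have "(\<lambda>j. g j \<omega>) ` J = {v1, v2} \<union> (\<lambda>i. f i \<omega>) ` I" for \<omega>
    by (auto simp: J_def g_def image_image)
  ultimately show ?thesis by simp
qed

section \<open>The uniform distribution on the triangle\<close>

lemma nn_integral_Beta_nat:
  "(\<integral>\<^sup>+u. ennreal (u ^ m * (1 - u) ^ k) * indicator {0<..<1} u \<partial>lborel)
     = ennreal (fact m * fact k / fact (m + k + 1))"
proof -
  have "((\<lambda>t::real. t powr (real (Suc m) - 1) * (1 - t) powr (real (Suc k) - 1))
      has_integral Beta (real (Suc m)) (real (Suc k))) {0<..<1}"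
    using has_integral_Beta_real[of "real (Suc m)" "real (Suc k)"] by (simp add: has_integral_Icc_iff_Ioo)
  then have "((\<lambda>t::real. t ^ m * (1 - t) ^ k) has_integral Beta (real (Suc m)) (real (Suc k))) {0<..<1}"
    by (rule has_integral_eq[rotated]) (auto simp: powr_realpow)
  also have "Beta (real (Suc m)) (real (Suc k)) = fact m * fact k / fact (m + k + 1)"
    unfolding Beta_def using Gamma_fact[of m, where ?'a = real] Gamma_fact[of k, where ?'a = real]
      Gamma_fact[of "m + k + 1", where ?'a = real]
    by (simp add: add_ac)
  finally have "(\<integral>\<^sup>+t. ennreal (indicator {0<..<1} t * (t ^ m * (1 - t) ^ k)) \<partial>lborel)
     = ennreal (fact m * fact k / fact (m + k + 1))"
    by (rule nn_integral_has_integral_lebesgue[rotated]) simp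
  then show ?thesis by (simp add: ennreal_mult' ennreal_indicator mult.commute)
qed

lemma fst_snd_borel [measurable (raw)]:
  fixes f :: "'a \<Rightarrow> real \<times> real"
  assumes "f \<in> borel_measurable M"
  shows "(\<lambda>x. fst (f x)) \<in> borel_measurable M" "(\<lambda>x. snd (f x)) \<in> borel_measurable M"
  using measurable_compose[OF assms borel_measurable_continuous_onI[OF continuous_on_fst[OF continuous_on_id]]]
    measurable_compose[OF assms borel_measurable_continuous_onI[OF continuous_on_snd[OF continuous_on_id]]]
  by simp_all

lemma T_borel [measurable]: "T \<in> sets borel"
  unfolding T_eq by measurable

lemma above_borel [measurable]: "above q \<in> sets borel"
  unfolding above_def by measurable

lemma renorm_borel [measurable]: "renorm u q \<in> borel_measurable borel"
  unfolding renorm_def by measurable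

lemma nn_integral_lborel_pair:
  fixes f :: "real \<times> real \<Rightarrow> ennreal"
  assumes f: "f \<in> borel_measurable borel"
  shows "(\<integral>\<^sup>+p. f p \<partial>lborel) = (\<integral>\<^sup>+a. \<integral>\<^sup>+b. f (a, b) \<partial>lborel \<partial>lborel)"
proof -
  have "f \<in> borel_measurable (lborel \<Otimes>\<^sub>M lborel)" using f by (simp add: lborel_prod)
  from lborel.nn_integral_fst[OF this] show ?thesis by (simp add: lborel_prod)
qed

text \<open>Coordinates adapted to \<open>v1\<close>: the point \<open>(1 - u, u * q)\<close> lies at the fraction \<open>u\<close> of the way
  from \<open>v1\<close> to \<open>(0, q)\<close>, and the area element is \<open>u du dq\<close>.\<close>
lemma nn_integral_T_polar:
  fixes f :: "real \<times> real \<Rightarrow> ennreal"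
  assumes [measurable]: "f \<in> borel_measurable borel"
  shows "(\<integral>\<^sup>+p. f p * indicator T p \<partial>lborel)
     = (\<integral>\<^sup>+u. (\<integral>\<^sup>+q. ennreal u * f (1 - u, u * q) * indicator {0<..<1} q \<partial>lborel) * indicator {0<..<1} u \<partial>lborel)"
proof -
  have "(\<integral>\<^sup>+p. f p * indicator T p \<partial>lborel)
      = (\<integral>\<^sup>+a. \<integral>\<^sup>+b. f (a, b) * indicator T (a, b) \<partial>lborel \<partial>lborel)"
    by (rule nn_integral_lborel_pair) simp
  also have "\<dots> = (\<integral>\<^sup>+u. \<integral>\<^sup>+b. f (1 - u, b) * indicator T (1 - u, b) \<partial>lborel \<partial>lborel)"
    by (subst nn_integral_real_affine[where c = "-1" and t = 1]) simp_all
  also have "\<dots> = (\<integral>\<^sup>+u. (\<integral>\<^sup>+q. ennreal u * f (1 - u, u * q) * indicator {0<..<1} q \<partial>lborel) * indicator {0<..<1} u \<partial>lborel)"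
  proof (rule nn_integral_cong_AE)
    have "AE u in lborel. u \<noteq> (0::real)" "AE u in lborel. u \<noteq> (1::real)"
      by (auto intro: AE_lborel_singleton)
    then show "AE u in lborel. (\<integral>\<^sup>+b. f (1 - u, b) * indicator T (1 - u, b) \<partial>lborel)
       = (\<integral>\<^sup>+q. ennreal u * f (1 - u, u * q) * indicator {0<..<1} q \<partial>lborel) * indicator {0<..<1} u"
    proof eventually_elim
      case (elim u)
      show ?case
      proof (cases "0 < u \<and> u < 1")
        case False
        then have "(1 - u, b) \<notin> T" for b using elim by (auto simp: T_eq)
        then show ?thesis using False by (simp add: indicator_def)
      next
        case True
        have "(\<integral>\<^sup>+b. f (1 - u, b) * indicator T (1 - u, b) \<partial>lborel)
          = ennreal u * (\<integral>\<^sup>+q. f (1 - u, u * q) * indicator T (1 - u, u * q) \<partial>lborel)"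
          using True by (subst nn_integral_real_affine[where c = u and t = 0]) simp_all
        also have "(\<integral>\<^sup>+q. f (1 - u, u * q) * indicator T (1 - u, u * q) \<partial>lborel)
           = (\<integral>\<^sup>+q. f (1 - u, u * q) * indicator {0<..<1} q \<partial>lborel)"
        proof (rule nn_integral_cong_AE)
          have "AE q in lborel. q \<noteq> (0::real)" "AE q in lborel. q \<noteq> (1::real)"
            by (auto intro: AE_lborel_singleton)
          then show "AE q in lborel. f (1 - u, u * q) * indicator T (1 - u, u * q)
              = f (1 - u, u * q) * indicator {0<..<1} q"
            by eventually_elim (use True in \<open>auto simp: T_eq indicator_def zero_le_mult_iff mult_le_cancel_left1\<close>)
        qed
        finally show ?thesis using True by (simp add: nn_integral_cmult mult.assoc)
      qed
    qed
  qed
  finally show ?thesis .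
qed

lemma emeasure_T: "emeasure lborel T = ennreal (1 / 2)"
proof -
  have "emeasure lborel T = (\<integral>\<^sup>+p. 1 * indicator T p \<partial>lborel)" by simp
  also have "\<dots> = (\<integral>\<^sup>+u. ennreal (u ^ 1 * (1 - u) ^ 0) * indicator {0<..<1} u \<partial>lborel)"
    by (subst nn_integral_T_polar) (simp_all add: nn_integral_cmult)
  also have "\<dots> = ennreal (1 / 2)" by (subst nn_integral_Beta_nat) (simp add: numeral_2_eq_2)
  finally show ?thesis .
qed

definition unif_T :: "(real \<times> real) measure" where
  "unif_T = density lborel (\<lambda>x. indicator T x / measure lborel T)"

lemma sets_unif_T [measurable_cong, simp]: "sets unif_T = sets borel"
  by (simp add: unif_T_def)

lemma space_unif_T [simp]: "space unif_T = UNIV"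
  by (simp add: unif_T_def)

lemma nn_integral_unif_T:
  assumes [measurable]: "f \<in> borel_measurable borel"
  shows "(\<integral>\<^sup>+p. f p \<partial>unif_T) = 2 * (\<integral>\<^sup>+p. f p * indicator T p \<partial>lborel)"
proof -
  have m: "measure lborel T = 1 / 2" unfolding measure_def emeasure_T by (rule enn2real_ennreal) simp
  have half: "ennreal (indicator T p / (1 / 2)) = 2 * indicator T p" for p
    by (simp split: split_indicator)
  show ?thesis
    unfolding unif_T_def m half
    by (subst nn_integral_density) (auto simp: nn_integral_cmult[symmetric] mult_ac)
qed

lemma nn_integral_unif_T_polar:
  assumes [measurable]: "f \<in> borel_measurable borel"
  shows "(\<integral>\<^sup>+p. f p \<partial>unif_T)
     = (\<integral>\<^sup>+u. (\<integral>\<^sup>+q. ennreal (2 * u) * f (1 - u, u * q) * indicator {0<..<1} q \<partial>lborel) * indicator {0<..<1} u \<partial>lborel)"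
  unfolding nn_integral_unif_T[OF assms] nn_integral_T_polar[OF assms]
  by (subst nn_integral_cmult[symmetric], simp)
     (auto intro!: nn_integral_cong simp: indicator_def ennreal_mult nn_integral_cmult[symmetric] mult.assoc)

lemma prob_space_unif_T: "prob_space unif_T"
proof
  have "emeasure unif_T (space unif_T) = (\<integral>\<^sup>+p. 1 \<partial>unif_T)" by simp
  also have "\<dots> = 2 * emeasure lborel T" by (subst nn_integral_unif_T) simp_all
  also have "\<dots> = 1" unfolding emeasure_T by (subst ennreal_numeral[symmetric], subst ennreal_mult[symmetric]) simp_all
  finally show "emeasure unif_T (space unif_T) = 1" .
qed

text \<open>The parameter \<open>c\<close> allows one exceptional slope \<open>q\<close>; with it, almost every point has a slope
  different from a given one.\<close>
lemma AE_unif_T_polar: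
  assumes [measurable]: "Measurable.pred borel P"
    and P: "\<And>u q. 0 < u \<Longrightarrow> u < 1 \<Longrightarrow> 0 < q \<Longrightarrow> q < 1 \<Longrightarrow> q \<noteq> c \<Longrightarrow> P (1 - u, u * q)"
  shows "AE p in unif_T. P p"
proof -
  have "(\<integral>\<^sup>+p. indicator {p. \<not> P p} p \<partial>unif_T)
     = (\<integral>\<^sup>+u. (\<integral>\<^sup>+q. ennreal (2 * u) * indicator {p. \<not> P p} (1 - u, u * q) * indicator {0<..<1} q \<partial>lborel) * indicator {0<..<1} u \<partial>lborel)"
    by (rule nn_integral_unif_T_polar) simp
  also have "\<dots> = (\<integral>\<^sup>+u. 0 \<partial>(lborel :: real measure))"
  proof (rule nn_integral_cong)
    fix u :: real
    have "AE q in lborel. q \<noteq> c" by (rule AE_lborel_singleton)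
    then have "AE q in lborel. ennreal (2 * u) * indicator {p. \<not> P p} (1 - u, u * q) * indicator {0<..<1} q = 0"
      if "0 < u" "u < 1"
      by eventually_elim (use P that in \<open>auto simp: indicator_def\<close>)
    then show "(\<integral>\<^sup>+q. ennreal (2 * u) * indicator {p. \<not> P p} (1 - u, u * q) * indicator {0<..<1} q \<partial>lborel) * indicator {0<..<1} u = 0"
      by (cases "u \<in> {0<..<1}") (auto simp: nn_integral_0_iff_AE)
  qed
  finally have "(\<integral>\<^sup>+p. indicator {p. \<not> P p} p \<partial>unif_T) = 0" by simp
  then have "emeasure unif_T {p. \<not> P p} = 0" by (subst (asm) nn_integral_indicator) auto
  then show ?thesis by (intro AE_I[of _ _ "{p. \<not> P p}"]) auto
qed

text \<open>The map is triangular, so two one-dimensional affine substitutions suffice.\<close>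
lemma nn_integral_renorm:
  fixes g :: "real \<times> real \<Rightarrow> ennreal"
  assumes u: "u < 1" and q: "q < 1" and [measurable]: "g \<in> borel_measurable borel"
  shows "(\<integral>\<^sup>+p. g (renorm u q p) \<partial>lborel) = ennreal ((1 - u) * (1 - q)) * (\<integral>\<^sup>+p. g p \<partial>lborel)"
proof -
  have "(\<integral>\<^sup>+p. g (renorm u q p) \<partial>lborel) = (\<integral>\<^sup>+a. \<integral>\<^sup>+b. g (renorm u q (a, b)) \<partial>lborel \<partial>lborel)"
    by (rule nn_integral_lborel_pair) simp
  also have "\<dots> = (\<integral>\<^sup>+a. ennreal (1 - q) * (\<integral>\<^sup>+y. g (a / (1 - u), y) \<partial>lborel) \<partial>lborel)"
  proof (rule nn_integral_cong)
    fix a :: real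
    show "(\<integral>\<^sup>+b. g (renorm u q (a, b)) \<partial>lborel) = ennreal (1 - q) * (\<integral>\<^sup>+y. g (a / (1 - u), y) \<partial>lborel)"
      using q by (subst nn_integral_real_affine[where c = "1 - q" and t = "q * (1 - a)"])
        (simp_all add: renorm_def)
  qed
  also have "\<dots> = ennreal (1 - q) * (\<integral>\<^sup>+a. \<integral>\<^sup>+y. g (a / (1 - u), y) \<partial>lborel \<partial>lborel)"
    by (rule nn_integral_cmult) simp
  also have "(\<integral>\<^sup>+a. \<integral>\<^sup>+y. g (a / (1 - u), y) \<partial>lborel \<partial>lborel)
      = ennreal (1 - u) * (\<integral>\<^sup>+x. \<integral>\<^sup>+y. g (x, y) \<partial>lborel \<partial>lborel)"
    using u by (subst nn_integral_real_affine[where c = "1 - u" and t = 0]) simp_all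
  also have "(\<integral>\<^sup>+x. \<integral>\<^sup>+y. g (x, y) \<partial>lborel \<partial>lborel) = (\<integral>\<^sup>+p. g p \<partial>lborel)"
    by (rule nn_integral_lborel_pair[symmetric]) simp
  finally show ?thesis using u q by (simp add: ennreal_mult mult_ac)
qed

text \<open>The triangle with vertices \<open>(1 - u, u * q)\<close>, \<open>(0, q)\<close> and \<open>v2\<close>, without its lower edge.\<close>
definition corner :: "real \<Rightarrow> real \<Rightarrow> (real \<times> real) set" where
  "corner u q = {p. renorm u q p \<in> T \<and> 0 < snd (renorm u q p)}"

lemma corner_borel [measurable]: "corner u q \<in> sets borel"
  unfolding corner_def by measurable

lemma corner_subset:
  assumes u: "0 < u" "u < 1" and q: "0 < q" "q < 1"
  shows "corner u q \<subseteq> T \<inter> above q"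
proof
  fix p assume "p \<in> corner u q"
  then have h: "0 \<le> fst p / (1 - u)" "0 < (snd p - q * (1 - fst p)) / (1 - q)"
    "fst p / (1 - u) + (snd p - q * (1 - fst p)) / (1 - q) \<le> 1"
    by (auto simp: corner_def T_eq renorm_def)
  then have a: "0 \<le> fst p" and b: "q * (1 - fst p) < snd p" using u q by (auto simp: zero_le_divide_iff zero_less_divide_iff)
  have "fst p * 1 \<le> fst p / (1 - u)" using a u by (simp add: field_simps)
  then have l: "fst p + (snd p - q * (1 - fst p)) / (1 - q) \<le> 1" using h by simp
  then have "fst p + snd p \<le> 1" using q by (simp add: field_simps)
  moreover have "fst p \<le> 1" using l h by linarith
  then have "0 \<le> q * (1 - fst p)" using q by simp
  ultimately show "p \<in> T \<inter> above q" using a b by (auto simp: T_eq above_def)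
qed

text \<open>A uniform point of \<open>T\<close> falls into the corner with probability \<open>(1 - u) * (1 - q)\<close>, and given that
  it does, \<open>renorm\<close> makes it uniform on \<open>T\<close> again.\<close>
lemma nn_integral_corner:
  assumes u: "0 < u" "u < 1" and q: "0 < q" "q < 1" and [measurable]: "f \<in> borel_measurable borel"
  shows "(\<integral>\<^sup>+p. f (renorm u q p) * indicator (corner u q) p \<partial>unif_T)
     = ennreal ((1 - u) * (1 - q)) * (\<integral>\<^sup>+p. f p \<partial>unif_T)"
proof -
  define g where "g p = f p * indicator (T \<inter> {p. 0 < snd p}) p" for p
  have [measurable]: "g \<in> borel_measurable borel" unfolding g_def by measurable
  have "f (renorm u q p) * indicator (corner u q) p * indicator T p = g (renorm u q p)" for p
  proof (cases "p \<in> corner u q")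
    case True
    then have "p \<in> T" using corner_subset[OF u q] by blast
    then show ?thesis using True by (simp add: g_def corner_def)
  qed (auto simp: g_def corner_def)
  then have "(\<integral>\<^sup>+p. f (renorm u q p) * indicator (corner u q) p \<partial>unif_T)
      = 2 * (\<integral>\<^sup>+p. g (renorm u q p) \<partial>lborel)"
    by (subst nn_integral_unif_T) simp_all
  also have "\<dots> = ennreal ((1 - u) * (1 - q)) * (2 * (\<integral>\<^sup>+p. g p \<partial>lborel))"
    using u q by (subst nn_integral_renorm) (simp_all add: mult_ac)
  also have "2 * (\<integral>\<^sup>+p. g p \<partial>lborel) = (\<integral>\<^sup>+p. f p * indicator {p. 0 < snd p} p \<partial>unif_T)"
    by (subst nn_integral_unif_T)
       (auto intro!: arg_cong2[where f = "(*)"] nn_integral_cong simp: g_def split: split_indicator)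
  also have "\<dots> = (\<integral>\<^sup>+p. f p \<partial>unif_T)"
  proof (rule nn_integral_cong_AE)
    have "AE p in unif_T. 0 < snd p" by (rule AE_unif_T_polar) auto
    then show "AE p in unif_T. f p * indicator {p. 0 < snd p} p = f p"
      by eventually_elim simp
  qed
  finally show ?thesis .
qed

lemma emeasure_above:
  assumes "0 < q" "q < 1"
  shows "emeasure unif_T (above q) = ennreal (1 - q)"
proof -
  have "emeasure unif_T (above q) = (\<integral>\<^sup>+p. indicator (above q) p \<partial>unif_T)"
    by simp
  also have "\<dots> = (\<integral>\<^sup>+u. (\<integral>\<^sup>+s. ennreal (2 * u) * indicator (above q) (1 - u, u * s) * indicator {0<..<1} s \<partial>lborel) * indicator {0<..<1} u \<partial>lborel)"
    by (rule nn_integral_unif_T_polar) simp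
  also have "\<dots> = (\<integral>\<^sup>+u. ennreal (2 * (1 - q)) * (ennreal (u ^ 1 * (1 - u) ^ 0) * indicator {0<..<1} u) \<partial>lborel)"
  proof (intro nn_integral_cong)
    fix u :: real
    show "(\<integral>\<^sup>+s. ennreal (2 * u) * indicator (above q) (1 - u, u * s) * indicator {0<..<1} s \<partial>lborel) * indicator {0<..<1} u
       = ennreal (2 * (1 - q)) * (ennreal (u ^ 1 * (1 - u) ^ 0) * indicator {0<..<1} u)"
    proof (cases "u \<in> {0<..<1}")
      case True
      have "(\<integral>\<^sup>+s. ennreal (2 * u) * indicator (above q) (1 - u, u * s) * indicator {0<..<1} s \<partial>lborel)
         = (\<integral>\<^sup>+s. ennreal (2 * u) * indicator {q<..<1} s \<partial>lborel)"
        using True assms by (intro nn_integral_cong)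
          (auto simp: above_def mult.commute split: split_indicator)
      also have "\<dots> = ennreal (2 * u) * ennreal (1 - q)"
        using assms by (subst nn_integral_cmult) simp_all
      also have "\<dots> = ennreal (2 * (1 - q)) * ennreal u"
        using True assms by (simp add: mult_ac flip: ennreal_mult)
      finally show ?thesis using True by simp
    qed simp
  qed
  also have "\<dots> = ennreal (2 * (1 - q)) * ennreal (1 / 2)"
    by (subst nn_integral_cmult) (simp_all add: nn_integral_Beta_nat[of 1 0, simplified] numeral_2_eq_2)
  also have "\<dots> = ennreal (1 - q)" using assms by (subst ennreal_mult[symmetric]) simp_all
  finally show ?thesis .
qed

lemma emeasure_corner:
  assumes "0 < u" "u < 1" "0 < q" "q < 1"
  shows "emeasure unif_T (corner u q) = ennreal ((1 - u) * (1 - q))"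
proof -
  interpret prob_space unif_T by (rule prob_space_unif_T)
  show ?thesis using nn_integral_corner[OF assms, of "\<lambda>_. 1"] emeasure_space_1 by simp
qed

lemma emeasure_above_minus_corner:
  assumes uq: "0 < u" "u < 1" "0 < q" "q < 1"
  shows "emeasure unif_T (above q - corner u q) = ennreal (u * (1 - q))"
proof -
  have "emeasure unif_T (above q - corner u q) = emeasure unif_T (above q) - emeasure unif_T (corner u q)"
    using corner_subset[OF uq] emeasure_corner[OF uq] by (intro emeasure_Diff) auto
  also have "\<dots> = ennreal ((1 - q) - (1 - u) * (1 - q))"
    using uq by (simp add: emeasure_corner emeasure_above ennreal_minus)
  finally show ?thesis by (simp add: algebra_simps)
qed

section \<open>Integrating out the points when the first vertex is given\<close>

interpretation unif_T: prob_space unif_T by (rule prob_space_unif_T)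

interpretation unif_PiM: product_sigma_finite "\<lambda>_ :: nat. unif_T" by standard

lemma measurable_pow_f0_hull:
  fixes f :: "nat \<Rightarrow> 'a \<Rightarrow> real \<times> real"
  assumes "0 < z" "finite I" "\<And>i. i \<in> I \<Longrightarrow> f i \<in> borel_measurable M"
  shows "(\<lambda>\<omega>. ennreal (z ^ f0 (convex hull ({v1, v2} \<union> (\<lambda>i. f i \<omega>) ` I)))) \<in> borel_measurable M"
proof -
  have "z ^ n = exp (real n * ln z)" for n
    using \<open>0 < z\<close> by (simp add: exp_of_nat_mult)
  then show ?thesis
    using measurable_f0_hull[OF assms(2,3)] by simp
qed

text \<open>The probability generating function of the number of vertices, for points indexed by \<open>I\<close>. Arbitrary
  index sets occur because the recursion passes to the subset of points that fall into the corner.\<close>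
definition vertex_pgf :: "real \<Rightarrow> nat set \<Rightarrow> ennreal" where
  "vertex_pgf z I = (\<integral>\<^sup>+\<omega>. ennreal (z ^ f0 (convex hull ({v1, v2} \<union> \<omega> ` I))) \<partial>(\<Pi>\<^sub>M i\<in>I. unif_T))"

text \<open>The points of \<open>K\<close>, conditioned to lie in the corner and mapped back by \<open>renorm\<close>, are again independent
  and uniform on \<open>T\<close>.\<close>
lemma nn_integral_PiM_corner:
  fixes K :: "nat set"
  assumes uq: "0 < u" "u < 1" "0 < q" "q < 1" and "finite K"
    and "F \<in> borel_measurable (\<Pi>\<^sub>M k\<in>K. unif_T)"
  shows "(\<integral>\<^sup>+\<omega>. (\<Prod>k\<in>K. indicator (corner u q) (\<omega> k)) * F (\<lambda>k\<in>K. renorm u q (\<omega> k)) \<partial>(\<Pi>\<^sub>M k\<in>K. unif_T))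
      = ennreal ((1 - u) * (1 - q)) ^ card K * (\<integral>\<^sup>+\<omega>. F \<omega> \<partial>(\<Pi>\<^sub>M k\<in>K. unif_T))"
  using \<open>finite K\<close> assms(6)
proof (induction K arbitrary: F rule: finite_induct)
  case empty
  then show ?case by (simp add: PiM_empty nn_integral_count_space_finite restrict_def)
next
  case (insert k K)
  note [measurable] = insert.prems
  \<comment> \<open>the last coordinate is integrated out first\<close>
  define F' where "F' x = (\<integral>\<^sup>+y. F (x(k := y)) \<partial>unif_T)" for x
  have [measurable]: "F' \<in> borel_measurable (\<Pi>\<^sub>M k\<in>K. unif_T)"
    unfolding F'_def by measurable
  have "(\<integral>\<^sup>+\<omega>. (\<Prod>k\<in>insert k K. indicator (corner u q) (\<omega> k)) * F (\<lambda>k\<in>insert k K. renorm u q (\<omega> k))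
          \<partial>(\<Pi>\<^sub>M k\<in>insert k K. unif_T))
      = (\<integral>\<^sup>+x. \<integral>\<^sup>+y. (\<Prod>j\<in>insert k K. indicator (corner u q) ((x(k := y)) j)) *
          F (\<lambda>j\<in>insert k K. renorm u q ((x(k := y)) j)) \<partial>unif_T \<partial>(\<Pi>\<^sub>M k\<in>K. unif_T))"
    using insert.hyps by (subst unif_PiM.product_nn_integral_insert) simp_all
  also have "\<dots> = (\<integral>\<^sup>+x. (\<Prod>j\<in>K. indicator (corner u q) (x j)) *
      (ennreal ((1 - u) * (1 - q)) * F' (\<lambda>j\<in>K. renorm u q (x j))) \<partial>(\<Pi>\<^sub>M k\<in>K. unif_T))"
  proof (rule nn_integral_cong)
    fix x assume "x \<in> space (\<Pi>\<^sub>M k\<in>K. unif_T)"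
    have sp: "(\<lambda>j\<in>K. renorm u q (x j)) \<in> space (\<Pi>\<^sub>M k\<in>K. unif_T)"
      by (auto simp: space_PiM)
    have m: "(\<lambda>y. F ((\<lambda>j\<in>K. renorm u q (x j))(k := y))) \<in> borel_measurable borel"
      using measurable_compose[OF measurable_component_update[OF sp insert.hyps(2)] insert.prems]
      by simp
    have 1: "(\<Prod>j\<in>insert k K. indicator (corner u q) ((x(k := y)) j))
        = (\<Prod>j\<in>K. indicator (corner u q) (x j)) * (indicator (corner u q) y :: ennreal)" for y
      using insert.hyps by (simp add: mult.commute, intro disjI2 arg_cong2[where f = "(*)"] refl prod.cong) auto
    have 2: "(\<lambda>j\<in>insert k K. renorm u q ((x(k := y)) j)) = (\<lambda>j\<in>K. renorm u q (x j))(k := renorm u q y)" for y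
      using insert.hyps by (auto simp: fun_eq_iff)
    show "(\<integral>\<^sup>+y. (\<Prod>j\<in>insert k K. indicator (corner u q) ((x(k := y)) j)) *
          F (\<lambda>j\<in>insert k K. renorm u q ((x(k := y)) j)) \<partial>unif_T)
       = (\<Prod>j\<in>K. indicator (corner u q) (x j)) *
      (ennreal ((1 - u) * (1 - q)) * F' (\<lambda>j\<in>K. renorm u q (x j)))"
      unfolding 1 2 F'_def using nn_integral_corner[OF uq m] m measurable_compose[OF renorm_borel m]
      by (simp add: mult.assoc mult.commute[of "indicator (corner u q) _"] nn_integral_cmult)
  qed
  also have "\<dots> = ennreal ((1 - u) * (1 - q)) * (\<integral>\<^sup>+x. (\<Prod>j\<in>K. indicator (corner u q) (x j)) *
       F' (\<lambda>j\<in>K. renorm u q (x j)) \<partial>(\<Pi>\<^sub>M k\<in>K. unif_T))"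
    by (subst nn_integral_cmult[symmetric]) (simp_all add: mult_ac)
  also have "\<dots> = ennreal ((1 - u) * (1 - q)) ^ card (insert k K) * (\<integral>\<^sup>+x. F' x \<partial>(\<Pi>\<^sub>M k\<in>K. unif_T))"
    using insert.hyps by (subst insert.IH) (simp_all add: mult.assoc)
  also have "(\<integral>\<^sup>+x. F' x \<partial>(\<Pi>\<^sub>M k\<in>K. unif_T)) = (\<integral>\<^sup>+\<omega>. F \<omega> \<partial>(\<Pi>\<^sub>M k\<in>insert k K. unif_T))"
    unfolding F'_def using insert.hyps by (intro unif_PiM.product_nn_integral_insert[symmetric]) simp_all
  finally show ?case .
qed

lemma AE_in_T: "AE p in unif_T. p \<in> T"
  by (rule AE_unif_T_polar) (auto simp: T_eq algebra_simps mult_le_cancel_left1 )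

lemma snd_renorm_pos_iff: "q < 1 \<Longrightarrow> 0 < snd (renorm u q p) \<longleftrightarrow> p \<in> above q"
  by (simp add: renorm_def above_def zero_less_divide_iff)

text \<open>The product of indicators is expanded over the set \<open>K\<close> of those indices whose points lie in the
  corner; on each term the number of vertices is given by the points in the corner alone.\<close>
lemma pow_f0_split_corner:
  fixes \<omega> :: "nat \<Rightarrow> real \<times> real"
  assumes uq: "0 < u" "u < 1" "0 < q" "q < 1" and "finite J" and z: "0 < z"
    and T: "\<And>j. j \<in> J \<Longrightarrow> \<omega> j \<in> T"
  shows "(\<Prod>j\<in>J. indicator (above q) (\<omega> j)) *
        ennreal (z ^ f0 (convex hull ({v1, v2} \<union> insert (1 - u, u * q) (\<omega> ` J))))
    = (\<Sum>K\<in>Pow J. (\<Prod>k\<in>K. indicator (corner u q) (\<omega> k)) * (\<Prod>j\<in>J - K. indicator (above q - corner u q) (\<omega> j)) *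
        (ennreal z * ennreal (z ^ f0 (convex hull ({v1, v2} \<union> (\<lambda>k\<in>K. renorm u q (\<omega> k)) ` K)))))"
proof -
  let ?V = "ennreal (z ^ f0 (convex hull ({v1, v2} \<union> insert (1 - u, u * q) (\<omega> ` J))))"
  have "indicator (above q) p = indicator (corner u q) p + (indicator (above q - corner u q) p :: ennreal)" for p
    using corner_subset[OF uq] by (auto split: split_indicator)
  then have "(\<Prod>j\<in>J. indicator (above q) (\<omega> j)) * ?V
    = (\<Sum>K\<in>Pow J. (\<Prod>k\<in>K. indicator (corner u q) (\<omega> k)) * (\<Prod>j\<in>J - K. indicator (above q - corner u q) (\<omega> j)) * ?V)"
    using \<open>finite J\<close> by (simp add: prod_add sum_distrib_right)
  also have "\<dots> = (\<Sum>K\<in>Pow J. (\<Prod>k\<in>K. indicator (corner u q) (\<omega> k)) * (\<Prod>j\<in>J - K. indicator (above q - corner u q) (\<omega> j)) *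
        (ennreal z * ennreal (z ^ f0 (convex hull ({v1, v2} \<union> (\<lambda>k\<in>K. renorm u q (\<omega> k)) ` K)))))"
  proof (rule sum.cong)
    fix K assume "K \<in> Pow J"
    then have K: "K \<subseteq> J" "finite K" "finite (J - K)" using \<open>finite J\<close> finite_subset by auto
    show "(\<Prod>k\<in>K. indicator (corner u q) (\<omega> k)) * (\<Prod>j\<in>J - K. indicator (above q - corner u q) (\<omega> j)) * ?V
      = (\<Prod>k\<in>K. indicator (corner u q) (\<omega> k)) * (\<Prod>j\<in>J - K. indicator (above q - corner u q) (\<omega> j)) *
        (ennreal z * ennreal (z ^ f0 (convex hull ({v1, v2} \<union> (\<lambda>k\<in>K. renorm u q (\<omega> k)) ` K))))"
    proof (cases "(\<forall>k\<in>K. \<omega> k \<in> corner u q) \<and> (\<forall>j\<in>J - K. \<omega> j \<in> above q - corner u q)")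
      case True
      have "\<omega> ` J \<subseteq> T \<inter> above q" using True T corner_subset[OF uq] by blast
      moreover have "k \<in> K" if "k \<in> J" "renorm u q (\<omega> k) \<in> T" for k
        using True that snd_renorm_pos_iff[OF uq(4), of u "\<omega> k"] by (auto simp: corner_def)
      then have "renorm u q ` (\<omega> ` J) \<inter> T = (\<lambda>k\<in>K. renorm u q (\<omega> k)) ` K"
        using True K(1) by (auto simp: corner_def image_iff)
      ultimately show ?thesis
        using f0_hull_first_vertex[OF uq, of "\<omega> ` J"] \<open>finite J\<close> z by (simp add: ennreal_mult)
    next
      case False
      then have "(\<Prod>k\<in>K. indicator (corner u q) (\<omega> k)) * (\<Prod>j\<in>J - K. indicator (above q - corner u q) (\<omega> j)) = (0 :: ennreal)"
        using K by (auto simp: prod_zero_iff indicator_def)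
      then show ?thesis by (simp only: mult_zero_left)
    qed
  qed simp
  finally show ?thesis .
qed

text \<open>Given the first vertex, the points of \<open>K\<close> and of its complement are independent. The former
  contribute a rescaled copy of the original problem, the latter only the probability
  \<open>u * (1 - q)\<close> each of lying above the line but outside the corner.\<close>
lemma nn_integral_given_first_vertex:
  assumes uq: "0 < u" "u < 1" "0 < q" "q < 1" and "finite J" and z: "0 < z"
  shows "(\<integral>\<^sup>+\<omega>. (\<Prod>j\<in>J. indicator (above q) (\<omega> j)) *
        ennreal (z ^ f0 (convex hull ({v1, v2} \<union> insert (1 - u, u * q) (\<omega> ` J)))) \<partial>(\<Pi>\<^sub>M j\<in>J. unif_T))
    = (\<Sum>K\<in>Pow J. ennreal (z * ((1 - u) * (1 - q)) ^ card K * (u * (1 - q)) ^ card (J - K)) * vertex_pgf z K)"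
proof -
  define W where "W K \<omega> = ennreal (z ^ f0 (convex hull ({v1, v2} \<union> \<omega> ` K)))" for K and \<omega> :: "nat \<Rightarrow> real \<times> real"
  have W_meas: "(\<lambda>\<omega>. W K (f \<omega>)) \<in> borel_measurable M"
    if "finite K" "\<And>k. k \<in> K \<Longrightarrow> (\<lambda>\<omega>. f \<omega> k) \<in> borel_measurable M" for K M and f :: "_ \<Rightarrow> nat \<Rightarrow> real \<times> real"
    unfolding W_def using measurable_pow_f0_hull[OF z that(1), of "\<lambda>k \<omega>. f \<omega> k" M] that(2) by simp
  have AET: "AE \<omega> in (\<Pi>\<^sub>M j\<in>J. unif_T). \<forall>j\<in>J. \<omega> j \<in> T"
    using \<open>finite J\<close> AE_in_T by (auto intro!: AE_finite_allI AE_PiM_component unif_T.prob_space_axioms)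
  define G where "G K \<omega> = (\<Prod>k\<in>K. indicator (corner u q) (\<omega> k)) * (\<Prod>j\<in>J - K. indicator (above q - corner u q) (\<omega> j)) *
        (ennreal z * W K (\<lambda>k\<in>K. renorm u q (\<omega> k)))" for K and \<omega> :: "nat \<Rightarrow> real \<times> real"
  have G_meas: "G K \<in> borel_measurable (\<Pi>\<^sub>M j\<in>J. unif_T)" if "K \<subseteq> J" for K
  proof -
    have [measurable]: "(\<lambda>\<omega>. W K (\<lambda>k\<in>K. renorm u q (\<omega> k))) \<in> borel_measurable (\<Pi>\<^sub>M j\<in>J. unif_T)"
      by (intro W_meas)
         (use that finite_subset[OF that \<open>finite J\<close>] in \<open>auto intro!: measurable_compose[OF _ renorm_borel]
            measurable_component_singleton[of _ J "\<lambda>_. unif_T", unfolded measurable_cong_sets[OF refl sets_unif_T]]\<close>)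
    have [measurable]: "(\<lambda>\<omega>. \<omega> k) \<in> borel_measurable (\<Pi>\<^sub>M j\<in>J. unif_T)" if "k \<in> J" for k
      using that measurable_component_singleton[of k J "\<lambda>_. unif_T"] by simp
    show ?thesis unfolding G_def by measurable (use that in auto)
  qed
  have "(\<integral>\<^sup>+\<omega>. (\<Prod>j\<in>J. indicator (above q) (\<omega> j)) *
        ennreal (z ^ f0 (convex hull ({v1, v2} \<union> insert (1 - u, u * q) (\<omega> ` J)))) \<partial>(\<Pi>\<^sub>M j\<in>J. unif_T))
    = (\<integral>\<^sup>+\<omega>. (\<Sum>K\<in>Pow J. G K \<omega>) \<partial>(\<Pi>\<^sub>M j\<in>J. unif_T))"
    using AET
    by (intro nn_integral_cong_AE, eventually_elim)
       (use pow_f0_split_corner[OF uq \<open>finite J\<close> z] in \<open>simp add: G_def W_def\<close>)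
  also have "\<dots> = (\<Sum>K\<in>Pow J. \<integral>\<^sup>+\<omega>. G K \<omega> \<partial>(\<Pi>\<^sub>M j\<in>J. unif_T))"
    using G_meas by (intro nn_integral_sum) auto
  also have "\<dots> = (\<Sum>K\<in>Pow J. ennreal (z * ((1 - u) * (1 - q)) ^ card K * (u * (1 - q)) ^ card (J - K)) * vertex_pgf z K)"
  proof (rule sum.cong)
    fix K assume "K \<in> Pow J"
    then have K: "K \<subseteq> J" "finite K" "finite (J - K)" using \<open>finite J\<close> finite_subset by auto
    have KJ: "K \<union> (J - K) = J" using K by auto
    define A where "A x = (\<Prod>k\<in>K. indicator (corner u q) (x k)) * W K (\<lambda>k\<in>K. renorm u q (x k))" for x
    define B where "B y = (\<Prod>j\<in>J - K. indicator (above q - corner u q) (y j) :: ennreal)" for y :: "nat \<Rightarrow> real \<times> real"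
    have [measurable]: "(\<lambda>\<omega>. W K (\<lambda>k\<in>K. renorm u q (\<omega> k))) \<in> borel_measurable (\<Pi>\<^sub>M k\<in>K. unif_T)"
      using K
      by (intro W_meas) (auto intro!: measurable_compose[OF _ renorm_borel] measurable_component_singleton[of _ K "\<lambda>_. unif_T", unfolded measurable_cong_sets[OF refl sets_unif_T]])
    have A_meas [measurable]: "A \<in> borel_measurable (\<Pi>\<^sub>M k\<in>K. unif_T)"
      unfolding A_def by measurable
    have B_meas [measurable]: "B \<in> borel_measurable (\<Pi>\<^sub>M k\<in>J - K. unif_T)"
      unfolding B_def by measurable
    have intB: "(\<integral>\<^sup>+y. B y \<partial>(\<Pi>\<^sub>M k\<in>J - K. unif_T)) = ennreal (u * (1 - q)) ^ card (J - K)"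
      unfolding B_def using K uq
      by (subst unif_PiM.product_nn_integral_prod) (simp_all add: emeasure_above_minus_corner)
    have vW: "vertex_pgf z K = (\<integral>\<^sup>+\<omega>. W K \<omega> \<partial>(\<Pi>\<^sub>M k\<in>K. unif_T))"
      by (simp add: vertex_pgf_def W_def)
    have intA: "(\<integral>\<^sup>+x. A x \<partial>(\<Pi>\<^sub>M k\<in>K. unif_T)) = ennreal ((1 - u) * (1 - q)) ^ card K * vertex_pgf z K"
      unfolding A_def vW using K by (intro nn_integral_PiM_corner[OF uq] W_meas) simp_all
    have GAB: "G K (merge K (J - K) (x, y)) = ennreal z * A x * B y" for x y
    proof -
      have "(\<Prod>k\<in>K. indicator (corner u q) (merge K (J - K) (x, y) k)) = (\<Prod>k\<in>K. indicator (corner u q) (x k) :: ennreal)"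
        by (intro prod.cong) auto
      moreover have "(\<Prod>j\<in>J - K. indicator (above q - corner u q) (merge K (J - K) (x, y) j)) = B y"
        unfolding B_def by (intro prod.cong) auto
      moreover have "(\<lambda>k\<in>K. renorm u q (merge K (J - K) (x, y) k)) = (\<lambda>k\<in>K. renorm u q (x k))"
        by (auto simp: fun_eq_iff)
      ultimately show ?thesis unfolding G_def A_def by (simp add: mult_ac)
    qed
    have "(\<integral>\<^sup>+\<omega>. G K \<omega> \<partial>(\<Pi>\<^sub>M j\<in>J. unif_T)) = (\<integral>\<^sup>+x. \<integral>\<^sup>+y. G K (merge K (J - K) (x, y)) \<partial>(\<Pi>\<^sub>M j\<in>J - K. unif_T) \<partial>(\<Pi>\<^sub>M j\<in>K. unif_T))"
      using unif_PiM.product_nn_integral_fold[of K "J - K" "G K"] K G_meas[OF K(1)] KJ by simp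
    also have "\<dots> = ennreal z * (\<integral>\<^sup>+x. A x \<partial>(\<Pi>\<^sub>M k\<in>K. unif_T)) * (\<integral>\<^sup>+y. B y \<partial>(\<Pi>\<^sub>M k\<in>J - K. unif_T))"
      unfolding GAB by (simp add: nn_integral_cmult nn_integral_multc)
    also have "\<dots> = ennreal (z * ((1 - u) * (1 - q)) ^ card K * (u * (1 - q)) ^ card (J - K)) * vertex_pgf z K"
    proof -
      have "ennreal (z * a ^ k * b ^ m) = ennreal z * ennreal a ^ k * ennreal b ^ m"
        if "0 \<le> a" "0 \<le> b" for a b k m
        using that z by (simp add: ennreal_mult ennreal_power)
      then have "ennreal (z * ((1 - u) * (1 - q)) ^ card K * (u * (1 - q)) ^ card (J - K))
        = ennreal z * ennreal ((1 - u) * (1 - q)) ^ card K * ennreal (u * (1 - q)) ^ card (J - K)"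
        using uq by simp
      then show ?thesis unfolding intA intB by (simp only: mult_ac)
    qed
    finally show "(\<integral>\<^sup>+\<omega>. G K \<omega> \<partial>(\<Pi>\<^sub>M j\<in>J. unif_T))
      = ennreal (z * ((1 - u) * (1 - q)) ^ card K * (u * (1 - q)) ^ card (J - K)) * vertex_pgf z K" .
  qed simp
  finally show ?thesis .
qed

section \<open>Choosing the first vertex\<close>

lemma mult_swap_middle:
  fixes a b c d v :: ennreal
  assumes "a * b = c * d"
  shows "a * v * b = c * v * d"
proof -
  have "a * v * b = a * b * v" by (simp only: mult_ac)
  also have "\<dots> = c * v * d" unfolding assms by (simp only: mult_ac)
  finally show ?thesis .
qed

lemma measurable_PiM_unif_T_component:
  "i \<in> I \<Longrightarrow> (\<lambda>\<omega>. \<omega> i) \<in> borel_measurable (\<Pi>\<^sub>M i\<in>I. unif_T)"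
  using measurable_component_singleton[of i I "\<lambda>_. unif_T"]
  unfolding measurable_cong_sets[OF refl sets_unif_T] .

text \<open>The height at which the line from \<open>v1\<close> through \<open>p\<close> meets the second axis; the first vertex after
  \<open>v1\<close> is the point for which it is smallest.\<close>
definition slope :: "real \<times> real \<Rightarrow> real" where
  "slope p = snd p / (1 - fst p)"

lemma slope_borel [measurable]: "slope \<in> borel_measurable borel"
  unfolding slope_def by measurable

lemma slope_polar: "u \<noteq> 0 \<Longrightarrow> slope (1 - u, u * q) = q"
  by (simp add: slope_def)

lemma mem_above_slope: "fst p < 1 \<Longrightarrow> p \<in> above q \<longleftrightarrow> q < slope p"
  by (simp add: above_def slope_def field_simps)

lemma AE_slope_neq: "AE p in unif_T. slope p \<noteq> c"
  by (rule AE_unif_T_polar[where c = c]) (auto simp: slope_polar)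

lemma AE_fst_less_1: "AE p in unif_T. fst p < 1"
  by (rule AE_unif_T_polar) auto

lemma AE_PiM_slope_distinct:
  fixes I :: "nat set"
  assumes "finite I" "i \<in> I" "j \<in> I" "i \<noteq> j"
  shows "AE \<omega> in (\<Pi>\<^sub>M i\<in>I. unif_T). slope (\<omega> i) \<noteq> slope (\<omega> j)"
proof -
  define J where "J = I - {i}"
  have J: "finite J" "i \<notin> J" "I = insert i J" "j \<in> J" using assms by (auto simp: J_def)
  define N where "N = {\<omega> \<in> space (\<Pi>\<^sub>M i\<in>I. unif_T). slope (\<omega> i) = slope (\<omega> j)}"
  have [measurable]: "i \<in> I" "j \<in> I" using assms by auto
  have N_sets [measurable]: "N \<in> sets (\<Pi>\<^sub>M i\<in>I. unif_T)" unfolding N_def by measurable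
  have "emeasure (\<Pi>\<^sub>M i\<in>I. unif_T) N = (\<integral>\<^sup>+\<omega>. indicator N \<omega> \<partial>(\<Pi>\<^sub>M i\<in>I. unif_T))"
    by simp
  also have "\<dots> = (\<integral>\<^sup>+x. \<integral>\<^sup>+y. indicator N (x(i := y)) \<partial>unif_T \<partial>(\<Pi>\<^sub>M i\<in>J. unif_T))"
    using N_sets J(1,2) unfolding J(3) by (intro unif_PiM.product_nn_integral_insert) simp_all
  also have "\<dots> = (\<integral>\<^sup>+x. 0 \<partial>(\<Pi>\<^sub>M i\<in>J. unif_T))"
  proof (rule nn_integral_cong)
    fix x
    have "AE y in unif_T. indicator N (x(i := y)) = (0 :: ennreal)"
      using AE_slope_neq[of "slope (x j)"]
      by eventually_elim (use \<open>i \<noteq> j\<close> in \<open>auto simp: N_def indicator_def\<close>)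
    then have "(\<integral>\<^sup>+y. indicator N (x(i := y)) \<partial>unif_T) = (\<integral>\<^sup>+y. 0 \<partial>unif_T)"
      by (rule nn_integral_cong_AE)
    then show "(\<integral>\<^sup>+y. indicator N (x(i := y)) \<partial>unif_T) = 0" by simp
  qed
  finally have "emeasure (\<Pi>\<^sub>M i\<in>I. unif_T) N = 0" by simp
  then show ?thesis by (intro AE_I[of _ _ N]) (auto simp: N_def)
qed

text \<open>Only the index that minimises \<open>s\<close> contributes.\<close>
lemma sum_prod_strict_min:
  fixes s :: "'i \<Rightarrow> real"
  assumes "finite I" "I \<noteq> {}" "inj_on s I"
  shows "(\<Sum>i\<in>I. \<Prod>j\<in>I - {i}. if s i < s j then 1 else 0 :: ennreal) = 1"
proof -
  obtain i0 where i0: "i0 \<in> I" "\<And>j. j \<in> I \<Longrightarrow> s i0 \<le> s j"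
    using arg_min_if_finite[OF assms(1,2), of s] by (metis not_le)
  have "(\<Prod>j\<in>I - {i}. if s i < s j then 1 else 0 :: ennreal) = (if i = i0 then 1 else 0)" if "i \<in> I" for i
  proof (cases "i = i0")
    case True
    have "s i0 < s j" if "j \<in> I - {i0}" for j
      using i0 that \<open>inj_on s I\<close> by (metis DiffD1 DiffD2 inj_on_contraD less_eq_real_def singletonI)
    then show ?thesis using True by simp
  next
    case False
    then have "\<not> s i < s i0" "i0 \<in> I - {i}" using i0 that by (auto simp: not_less)
    then show ?thesis using False \<open>finite I\<close> by (auto intro!: bexI[of _ i0])
  qed
  then have "(\<Sum>i\<in>I. \<Prod>j\<in>I - {i}. if s i < s j then 1 else 0 :: ennreal) = (\<Sum>i\<in>I. if i = i0 then 1 else 0)"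
    by (intro sum.cong) auto
  then show ?thesis using i0(1) \<open>finite I\<close> by simp
qed

text \<open>The integrand with \<open>y\<close> in the role of the first vertex: the product restricts to the event that all
  other points have larger slope.\<close>
definition first_vertex_integrand :: "real \<Rightarrow> nat set \<Rightarrow> real \<times> real \<Rightarrow> (nat \<Rightarrow> real \<times> real) \<Rightarrow> ennreal" where
  "first_vertex_integrand z J y \<omega> = (\<Prod>j\<in>J. indicator (above (slope y)) (\<omega> j)) *
     ennreal (z ^ f0 (convex hull ({v1, v2} \<union> insert y (\<omega> ` J))))"

lemma measurable_first_vertex_integrand:
  assumes z: "0 < z" and J: "finite J"
    and [measurable]: "Y \<in> borel_measurable M" "\<And>j. j \<in> J \<Longrightarrow> (\<lambda>\<omega>. V \<omega> j) \<in> borel_measurable M"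
  shows "(\<lambda>\<omega>. first_vertex_integrand z J (Y \<omega>) (V \<omega>)) \<in> borel_measurable M"
proof -
  obtain m where m: "m \<notin> J" using ex_new_if_finite[OF infinite_UNIV_nat J] by blast
  \<comment> \<open>the unused index \<open>m\<close> serves as the label of the distinguished point\<close>
  define f where "f j = (if j = m then Y else (\<lambda>\<omega>. V \<omega> j))" for j
  have [measurable]: "(\<lambda>\<omega>. ennreal (z ^ f0 (convex hull ({v1, v2} \<union> insert (Y \<omega>) (V \<omega> ` J))))) \<in> borel_measurable M"
  proof -
    have "(\<lambda>\<omega>. ennreal (z ^ f0 (convex hull ({v1, v2} \<union> (\<lambda>j. f j \<omega>) ` insert m J)))) \<in> borel_measurable M"
      using J by (intro measurable_pow_f0_hull z) (auto simp: f_def)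
    moreover have "(\<lambda>j. f j \<omega>) ` insert m J = insert (Y \<omega>) (V \<omega> ` J)" for \<omega>
      using m by (auto simp: f_def image_iff)
    ultimately show ?thesis by (simp only:)
  qed
  have "(\<lambda>\<omega>. \<Prod>j\<in>J. indicator (above (slope (Y \<omega>))) (V \<omega> j) :: ennreal) \<in> borel_measurable M"
    unfolding above_def indicator_def mem_Collect_eq of_bool_def by measurable
  then show ?thesis unfolding first_vertex_integrand_def by measurable
qed

text \<open>Almost surely exactly one index attains the minimal slope, so the events that \<open>i\<close> is the first vertex
  form a partition.\<close>
lemma vertex_pgf_eq_sum_first_vertex:
  assumes z: "0 < z" and I: "finite I" "I \<noteq> {}"
  shows "vertex_pgf z I = (\<Sum>i\<in>I. \<integral>\<^sup>+y. \<integral>\<^sup>+\<omega>. first_vertex_integrand z (I - {i}) y \<omega>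
     \<partial>(\<Pi>\<^sub>M j\<in>I - {i}. unif_T) \<partial>unif_T)"
proof -
  let ?P = "\<Pi>\<^sub>M i\<in>I. unif_T"
  have comp [measurable]: "(\<lambda>\<omega>. \<omega> i) \<in> borel_measurable ?P" if "i \<in> I" for i
    using that by (rule measurable_PiM_unif_T_component)
  have L_meas: "(\<lambda>\<omega>. first_vertex_integrand z (I - {i}) (\<omega> i) \<omega>) \<in> borel_measurable ?P" if "i \<in> I" for i
    using I that by (intro measurable_first_vertex_integrand z) auto
  have "AE \<omega> in ?P. \<forall>i\<in>I. fst (\<omega> i) < 1"
    using I(1) AE_fst_less_1 by (auto intro!: AE_finite_allI AE_PiM_component unif_T.prob_space_axioms)
  moreover have "AE \<omega> in ?P. \<forall>i\<in>I. \<forall>j\<in>I - {i}. slope (\<omega> i) \<noteq> slope (\<omega> j)"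
    using I(1) by (intro AE_finite_allI) (auto intro!: AE_PiM_slope_distinct)
  ultimately have "AE \<omega> in ?P. ennreal (z ^ f0 (convex hull ({v1, v2} \<union> \<omega> ` I)))
      = (\<Sum>i\<in>I. first_vertex_integrand z (I - {i}) (\<omega> i) \<omega>)"
  proof eventually_elim
    case (elim \<omega>)
    have "first_vertex_integrand z (I - {i}) (\<omega> i) \<omega>
        = (\<Prod>j\<in>I - {i}. if slope (\<omega> i) < slope (\<omega> j) then 1 else 0) * ennreal (z ^ f0 (convex hull ({v1, v2} \<union> \<omega> ` I)))"
      if "i \<in> I" for i
    proof -
      have "insert (\<omega> i) (\<omega> ` (I - {i})) = \<omega> ` I" using that by auto
      moreover have "(\<Prod>j\<in>I - {i}. indicator (above (slope (\<omega> i))) (\<omega> j))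
          = (\<Prod>j\<in>I - {i}. if slope (\<omega> i) < slope (\<omega> j) then 1 else 0 :: ennreal)"
        using elim(1) by (intro prod.cong) (auto simp: mem_above_slope indicator_def)
      ultimately show ?thesis unfolding first_vertex_integrand_def by simp
    qed
    then have "(\<Sum>i\<in>I. first_vertex_integrand z (I - {i}) (\<omega> i) \<omega>)
       = (\<Sum>i\<in>I. \<Prod>j\<in>I - {i}. if slope (\<omega> i) < slope (\<omega> j) then 1 else 0) * ennreal (z ^ f0 (convex hull ({v1, v2} \<union> \<omega> ` I)))"
      by (simp add: sum_distrib_right)
    also have "(\<Sum>i\<in>I. \<Prod>j\<in>I - {i}. if slope (\<omega> i) < slope (\<omega> j) then 1 else 0 :: ennreal) = 1"
      using elim(2) by (intro sum_prod_strict_min[OF I]) (auto simp: inj_on_def)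
    finally show ?case by simp
  qed
  then have "vertex_pgf z I = (\<integral>\<^sup>+\<omega>. (\<Sum>i\<in>I. first_vertex_integrand z (I - {i}) (\<omega> i) \<omega>) \<partial>?P)"
    unfolding vertex_pgf_def by (rule nn_integral_cong_AE)
  also have "\<dots> = (\<Sum>i\<in>I. \<integral>\<^sup>+\<omega>. first_vertex_integrand z (I - {i}) (\<omega> i) \<omega> \<partial>?P)"
    using L_meas by (rule nn_integral_sum)
  also have "\<dots> = (\<Sum>i\<in>I. \<integral>\<^sup>+y. \<integral>\<^sup>+\<omega>. first_vertex_integrand z (I - {i}) y \<omega>
     \<partial>(\<Pi>\<^sub>M j\<in>I - {i}. unif_T) \<partial>unif_T)"
  proof (rule sum.cong)
    fix i assume "i \<in> I"
    then have ins: "insert i (I - {i}) = I" by auto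
    have upd: "first_vertex_integrand z (I - {i}) ((x(i := y)) i) (x(i := y)) = first_vertex_integrand z (I - {i}) y x" for x y
    proof -
      have "(x(i := y)) ` (I - {i}) = x ` (I - {i})" by auto
      moreover have "(\<Prod>j\<in>I - {i}. indicator (above (slope y)) ((x(i := y)) j))
         = (\<Prod>j\<in>I - {i}. indicator (above (slope y)) (x j) :: ennreal)" by (intro prod.cong) auto
      ultimately show ?thesis unfolding first_vertex_integrand_def by simp
    qed
    show "(\<integral>\<^sup>+\<omega>. first_vertex_integrand z (I - {i}) (\<omega> i) \<omega> \<partial>?P)
       = (\<integral>\<^sup>+y. \<integral>\<^sup>+\<omega>. first_vertex_integrand z (I - {i}) y \<omega> \<partial>(\<Pi>\<^sub>M j\<in>I - {i}. unif_T) \<partial>unif_T)"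
      using unif_PiM.product_nn_integral_insert_rev[of "I - {i}" i
          "\<lambda>\<omega>. first_vertex_integrand z (I - {i}) (\<omega> i) \<omega>"] L_meas[OF \<open>i \<in> I\<close>] I(1)
      unfolding ins upd by simp
  qed simp
  finally show ?thesis .
qed

text \<open>Integrating the first vertex out. In the coordinates \<open>(u, q)\<close> the integrand factors into powers of
  \<open>u\<close>, \<open>1 - u\<close> and \<open>1 - q\<close>, which gives two Beta integrals.\<close>
lemma nn_integral_first_vertex:
  assumes z: "0 < z" and J: "finite J"
  shows "(\<integral>\<^sup>+y. \<integral>\<^sup>+\<omega>. first_vertex_integrand z J y \<omega> \<partial>(\<Pi>\<^sub>M j\<in>J. unif_T) \<partial>unif_T)
    = (\<Sum>K\<in>Pow J. ennreal (2 * z * (fact (card (J - K) + 1) * fact (card K) / (real (card J + 1) * fact (card J + 2)))) * vertex_pgf z K)"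
proof -
  let ?n = "card J"
  have card: "card K + card (J - K) = ?n" if "K \<in> Pow J" for K
    using that J card_Un_disjoint[of K "J - K"] finite_subset[of K J] by (simp add: Un_absorb1)
  define \<Phi> where "\<Phi> y = (\<integral>\<^sup>+\<omega>. first_vertex_integrand z J y \<omega> \<partial>(\<Pi>\<^sub>M j\<in>J. unif_T))" for y
  have \<Phi>_eq: "\<Phi> (1 - u, u * q) = (\<Sum>K\<in>Pow J. ennreal (z * ((1 - u) * (1 - q)) ^ card K * (u * (1 - q)) ^ card (J - K)) * vertex_pgf z K)"
    if "0 < u" "u < 1" "0 < q" "q < 1" for u q
    using nn_integral_given_first_vertex[OF that J z] that
    unfolding \<Phi>_def first_vertex_integrand_def by (simp add: slope_polar)
  interpret PJ: prob_space "\<Pi>\<^sub>M j\<in>J. unif_T" by (intro prob_space_PiM prob_space_unif_T)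
  have "(\<lambda>p. first_vertex_integrand z J (fst p) (snd p)) \<in> borel_measurable (borel \<Otimes>\<^sub>M (\<Pi>\<^sub>M j\<in>J. unif_T))"
  proof (rule measurable_first_vertex_integrand[OF z J])
    fix j assume "j \<in> J"
    then show "(\<lambda>p. snd p j) \<in> borel_measurable (borel \<Otimes>\<^sub>M (\<Pi>\<^sub>M j\<in>J. unif_T))"
      by (intro measurable_compose[OF measurable_snd] measurable_PiM_unif_T_component)
  qed simp
  then have [measurable]: "\<Phi> \<in> borel_measurable borel"
    unfolding \<Phi>_def by (intro PJ.borel_measurable_nn_integral) (simp add: case_prod_unfold)
  have "(\<integral>\<^sup>+y. \<Phi> y \<partial>unif_T) = (\<integral>\<^sup>+u. (\<integral>\<^sup>+q. ennreal (2 * u) * \<Phi> (1 - u, u * q) * indicator {0<..<1} q \<partial>lborel) * indicator {0<..<1} u \<partial>lborel)"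
    by (rule nn_integral_unif_T_polar) simp
  also have "\<dots> = (\<integral>\<^sup>+u. (\<Sum>K\<in>Pow J. ennreal (2 * z / real (?n + 1)) * vertex_pgf z K *
       (ennreal (u ^ (card (J - K) + 1) * (1 - u) ^ card K) * indicator {0<..<1} u)) \<partial>lborel)"
  proof (rule nn_integral_cong)
    fix u :: real
    show "(\<integral>\<^sup>+q. ennreal (2 * u) * \<Phi> (1 - u, u * q) * indicator {0<..<1} q \<partial>lborel) * indicator {0<..<1} u
       = (\<Sum>K\<in>Pow J. ennreal (2 * z / real (?n + 1)) * vertex_pgf z K *
       (ennreal (u ^ (card (J - K) + 1) * (1 - u) ^ card K) * indicator {0<..<1} u))"
    proof (cases "u \<in> {0<..<1}")
      case u: True
      have "(\<integral>\<^sup>+q. ennreal (2 * u) * \<Phi> (1 - u, u * q) * indicator {0<..<1} q \<partial>lborel)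
        = (\<integral>\<^sup>+q. (\<Sum>K\<in>Pow J. ennreal (2 * z * (u ^ (card (J - K) + 1) * (1 - u) ^ card K)) * vertex_pgf z K)
            * (ennreal (q ^ 0 * (1 - q) ^ ?n) * indicator {0<..<1} q) \<partial>lborel)"
      proof (rule nn_integral_cong)
        fix q :: real
        show "ennreal (2 * u) * \<Phi> (1 - u, u * q) * indicator {0<..<1} q =
          (\<Sum>K\<in>Pow J. ennreal (2 * z * (u ^ (card (J - K) + 1) * (1 - u) ^ card K)) * vertex_pgf z K)
            * (ennreal (q ^ 0 * (1 - q) ^ ?n) * indicator {0<..<1} q)"
        proof (cases "q \<in> {0<..<1}")
          case q: True
          have "ennreal (2 * u) * (ennreal (z * ((1 - u) * (1 - q)) ^ card K * (u * (1 - q)) ^ card (J - K)) * vertex_pgf z K)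
            = ennreal (2 * z * (u ^ (card (J - K) + 1) * (1 - u) ^ card K)) * vertex_pgf z K * ennreal ((1 - q) ^ ?n)"
            if "K \<in> Pow J" for K
          proof -
            have "2 * u * (z * ((1 - u) * (1 - q)) ^ card K * (u * (1 - q)) ^ card (J - K))
              = 2 * z * (u ^ (card (J - K) + 1) * (1 - u) ^ card K) * (1 - q) ^ ?n"
              unfolding card[OF that, symmetric] power_add power_mult_distrib by simp
            then show ?thesis using u q z
              by (simp add: mult.assoc[symmetric] mult.commute[of "vertex_pgf z K"] flip: ennreal_mult)
                 (simp add: mult_ac flip: ennreal_mult)
          qed
          then show ?thesis using u q by (simp add: \<Phi>_eq sum_distrib_left sum_distrib_right)
        qed simp
      qed
      also have "\<dots> = (\<Sum>K\<in>Pow J. ennreal (2 * z * (u ^ (card (J - K) + 1) * (1 - u) ^ card K)) * vertex_pgf z K)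
            * ennreal (1 / real (?n + 1))"
        by (subst nn_integral_cmult, simp, subst nn_integral_Beta_nat) (simp add: fact_reduce)
      also have "\<dots> = (\<Sum>K\<in>Pow J. ennreal (2 * z / real (?n + 1)) * vertex_pgf z K *
       (ennreal (u ^ (card (J - K) + 1) * (1 - u) ^ card K) * indicator {0<..<1} u))"
        unfolding sum_distrib_right
      proof (rule sum.cong)
        fix K
        have "ennreal (2 * z * (u ^ (card (J - K) + 1) * (1 - u) ^ card K)) * ennreal (1 / real (?n + 1))
           = ennreal (2 * z / real (?n + 1)) * ennreal (u ^ (card (J - K) + 1) * (1 - u) ^ card K)"
          using u z by (subst (1 2) ennreal_mult[symmetric]) (simp_all add: divide_simps)
        from mult_swap_middle[OF this, of "vertex_pgf z K"]
        show "ennreal (2 * z * (u ^ (card (J - K) + 1) * (1 - u) ^ card K)) * vertex_pgf z K * ennreal (1 / real (?n + 1))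
          = ennreal (2 * z / real (?n + 1)) * vertex_pgf z K *
       (ennreal (u ^ (card (J - K) + 1) * (1 - u) ^ card K) * indicator {0<..<1} u)"
          using u by (simp only: indicator_simps mult_1_right)
      qed simp
      finally show ?thesis using u by simp
    qed simp
  qed
  also have "\<dots> = (\<Sum>K\<in>Pow J. ennreal (2 * z / real (?n + 1)) * vertex_pgf z K *
      ennreal (fact (card (J - K) + 1) * fact (card K) / fact (card (J - K) + 1 + card K + 1)))"
    by (subst nn_integral_sum, simp, intro sum.cong refl, subst nn_integral_cmult, simp, subst nn_integral_Beta_nat, simp)
  also have "\<dots> = (\<Sum>K\<in>Pow J. ennreal (2 * z * (fact (card (J - K) + 1) * fact (card K) / (real (card J + 1) * fact (card J + 2)))) * vertex_pgf z K)"
  proof (rule sum.cong)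
    fix K assume K: "K \<in> Pow J"
    have e: "card (J - K) + 1 + card K + 1 = ?n + 2" using card[OF K] by simp
    have "ennreal (2 * z / real (?n + 1)) * ennreal (fact (card (J - K) + 1) * fact (card K) / fact (?n + 2))
      = ennreal (2 * z * (fact (card (J - K) + 1) * fact (card K) / (real (card J + 1) * fact (card J + 2))))"
      using z by (subst ennreal_mult[symmetric]) simp_all
    then show "ennreal (2 * z / real (?n + 1)) * vertex_pgf z K *
      ennreal (fact (card (J - K) + 1) * fact (card K) / fact (card (J - K) + 1 + card K + 1))
      = ennreal (2 * z * (fact (card (J - K) + 1) * fact (card K) / (real (card J + 1) * fact (card J + 2)))) * vertex_pgf z K"
      unfolding e using mult_swap_middle[where d = 1 and v = "vertex_pgf z K"] by (simp only: mult_1_right)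
  qed simp
  finally show ?thesis unfolding \<Phi>_def .
qed

section \<open>The generating function of the number of vertices\<close>

text \<open>The polynomials with \<open>n (n + 1) G\<^sub>n(z) = 2 z (\<Sum>k<n. (n - k) G\<^sub>k(z))\<close> and \<open>G\<^sub>0 = 1\<close>. They are defined over
  any field so that the real ones, which are generating functions, can be continued to complex
  arguments.\<close>
fun chain_gf :: "nat \<Rightarrow> 'a :: field_char_0 \<Rightarrow> 'a" where
  "chain_gf n z = (if n = 0 then 1 else
     2 * z / (of_nat n * of_nat (n + 1)) * (\<Sum>k<n. of_nat (n - k) * chain_gf k z))"

declare chain_gf.simps [simp del]

lemma chain_gf_0 [simp]: "chain_gf 0 z = 1"
  by (subst chain_gf.simps) simp

lemma chain_gf_Suc:
  "chain_gf (Suc n) z = 2 * z / (of_nat (n + 1) * of_nat (n + 2)) * (\<Sum>k\<le>n. of_nat (n + 1 - k) * chain_gf k z)"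
  by (subst chain_gf.simps) (simp add: lessThan_Suc_atMost)

lemma chain_gf_of_real: "chain_gf n (of_real z) = (of_real (chain_gf n z) :: complex)"
proof (induction n rule: less_induct)
  case (less n)
  then show ?case
    by (cases n) (simp_all add: chain_gf_Suc less)
qed

lemma chain_gf_pos:
  fixes z :: real
  assumes "0 < z" shows "0 < chain_gf n z"
proof (induction n rule: less_induct)
  case (less n)
  show ?case
  proof (cases n)
    case (Suc m)
    have "0 < (\<Sum>k\<le>m. real (m + 1 - k) * chain_gf k z)"
      using less Suc by (intro sum_pos mult_pos_pos) auto
    then show ?thesis unfolding Suc chain_gf_Suc using assms by simp
  qed simp
qed

lemma holomorphic_on_chain_gf [holomorphic_intros]:
  assumes "f holomorphic_on S" shows "(\<lambda>t. chain_gf n (f t)) holomorphic_on S"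
proof (induction n rule: less_induct)
  case (less n)
  then show ?case
    by (cases n) (auto simp: chain_gf_Suc less_Suc_eq_le intro!: holomorphic_intros assms)
qed

lemma sum_Pow_card:
  fixes g :: "nat \<Rightarrow> real"
  assumes "finite J"
  shows "(\<Sum>K\<in>Pow J. g (card K)) = (\<Sum>k\<le>card J. real (card J choose k) * g k)"
proof -
  have "(\<Sum>K\<in>Pow J. g (card K)) = (\<Sum>k\<le>card J. \<Sum>K\<in>{K \<in> Pow J. card K = k}. g (card K))"
    using assms by (intro sum.group[symmetric]) (auto intro: card_mono)
  also have "\<dots> = (\<Sum>k\<le>card J. real (card J choose k) * g k)"
  proof (rule sum.cong)
    fix k
    have "card {K \<in> Pow J. card K = k} = card J choose k"
      using n_subsets[OF assms, of k] by (simp add: Pow_def)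
    then show "(\<Sum>K\<in>{K \<in> Pow J. card K = k}. g (card K)) = real (card J choose k) * g k" by simp
  qed simp
  finally show ?thesis .
qed

lemma f0_hull_v1_v2: "f0 (convex hull {v1, v2}) = 2"
proof -
  have "{x. x extreme_point_of (convex hull {v1, v2})} = {v1, v2}"
    by (auto simp: extreme_point_of_convex_hull_2)
  then show ?thesis by (simp add: f0_def v1_def v2_def)
qed

text \<open>Two of the vertices are \<open>v1\<close> and \<open>v2\<close>, which accounts for the factor \<open>z\<^sup>2\<close>; the remaining number of
  vertices has generating function \<open>chain_gf n\<close>. By induction, the integral over the first vertex
  depends on the subset \<open>K\<close> only through its size, and summing over \<open>K\<close> turns the Beta integrals into
  the weights \<open>n + 1 - k\<close> of the recursion.\<close>
proposition vertex_pgf_eq_chain_gf: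
  assumes z: "0 < z" and "finite I"
  shows "vertex_pgf z I = ennreal (z\<^sup>2 * chain_gf (card I) z)"
  using \<open>finite I\<close>
proof (induction "card I" arbitrary: I rule: less_induct)
  case (less I)
  show ?case
  proof (cases "I = {}")
    case True
    then show ?thesis
      by (simp add: vertex_pgf_def PiM_empty nn_integral_count_space_finite f0_hull_v1_v2)
  next
    case False
    define n where "n = card I - 1"
    have n: "card I = n + 1" using False less.prems by (simp add: n_def card_gt_0_iff Suc_leI)
    \<comment> \<open>the contribution of a single subset of size \<open>k\<close>\<close>
    define c where "c k = 2 * z * (fact (n - k + 1) * fact k / (real (n + 1) * fact (n + 2))) * (z\<^sup>2 * chain_gf k z)" for k
    have c_nonneg: "0 \<le> c k" for k using z chain_gf_pos[OF z, of k] by (simp add: c_def)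
    have "vertex_pgf z I = (\<Sum>i\<in>I. \<Sum>K\<in>Pow (I - {i}). ennreal (c (card K)))"
      unfolding vertex_pgf_eq_sum_first_vertex[OF z less.prems False]
    proof (rule sum.cong)
      fix i assume i: "i \<in> I"
      have J: "finite (I - {i})" "card (I - {i}) = n" using i less.prems n by auto
      show "(\<integral>\<^sup>+y. \<integral>\<^sup>+\<omega>. first_vertex_integrand z (I - {i}) y \<omega> \<partial>(\<Pi>\<^sub>M j\<in>I - {i}. unif_T) \<partial>unif_T)
        = (\<Sum>K\<in>Pow (I - {i}). ennreal (c (card K)))"
        unfolding nn_integral_first_vertex[OF z J(1)] J(2)
      proof (rule sum.cong)
        fix K assume "K \<in> Pow (I - {i})"
        then have K: "K \<subseteq> I - {i}" "finite K" using J(1) finite_subset by auto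
        have "card K \<le> n" using card_mono[OF J(1) K(1)] J(2) by simp
        then have "vertex_pgf z K = ennreal (z\<^sup>2 * chain_gf (card K) z)"
          using K n by (intro less.hyps) auto
        moreover have "card (I - {i} - K) = n - card K" using K J by (simp add: card_Diff_subset)
        ultimately show "ennreal (2 * z * (fact (card (I - {i} - K) + 1) * fact (card K) / (real (n + 1) * fact (n + 2)))) * vertex_pgf z K
          = ennreal (c (card K))"
          unfolding c_def using z chain_gf_pos[OF z, of "card K"] by (subst ennreal_mult) simp_all
      qed simp
    qed simp
    also have "\<dots> = ennreal (\<Sum>i\<in>I. \<Sum>K\<in>Pow (I - {i}). c (card K))"
      using c_nonneg by (simp add: sum_nonneg)
    also have "(\<Sum>i\<in>I. \<Sum>K\<in>Pow (I - {i}). c (card K)) = (\<Sum>i\<in>I. \<Sum>k\<le>n. real (n choose k) * c k)"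
      using less.prems n by (intro sum.cong refl) (simp add: sum_Pow_card)
    also have "\<dots> = real (n + 1) * (\<Sum>k\<le>n. real (n choose k) * c k)" by (simp add: n)
    also have "\<dots> = z\<^sup>2 * chain_gf (n + 1) z"
    proof -
      have "real (n + 1) * (real (n choose k) * c k)
          = z\<^sup>2 * (2 * z / (real (n + 1) * real (n + 2)) * (real (n + 1 - k) * chain_gf k z))"
        if "k \<le> n" for k
      proof -
        have "real (n choose k) * (fact (n - k + 1) * fact k) = fact n * real (n + 1 - k)"
        proof -
          have "real (n choose k) * (fact k * fact (n - k)) = fact n"
            using binomial_fact_lemma[OF that] by (metis (no_types, lifting) mult.commute of_nat_fact of_nat_mult)
          moreover have "fact (n - k + 1) = real (n + 1 - k) * fact (n - k)"
            using that by (simp add: Suc_diff_le)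
          moreover have "real (n choose k) * (real (n + 1 - k) * fact (n - k) * fact k)
             = real (n choose k) * (fact k * fact (n - k)) * real (n + 1 - k)" by (simp only: mult_ac)
          ultimately show ?thesis by (simp only:)
        qed
        moreover have "fact (n + 2) = real (n + 1) * real (n + 2) * fact n"
          by (simp add: algebra_simps)
        moreover have "real (n + 1) * (real (n choose k) * c k)
          = 2 * z * z\<^sup>2 * chain_gf k z * (real (n choose k) * (fact (n - k + 1) * fact k)) / fact (n + 2)"
          by (simp add: c_def)
        ultimately have "real (n + 1) * (real (n choose k) * c k)
          = 2 * z * z\<^sup>2 * chain_gf k z * (fact n * real (n + 1 - k)) / (real (n + 1) * real (n + 2) * fact n)"
          by simp
        then show ?thesis by simp
      qed
      then show ?thesis by (simp add: chain_gf_Suc sum_distrib_left)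
    qed
    finally show ?thesis by (simp add: n)
  qed
qed

section \<open>The hypergeometric solution of the recursion\<close>

text \<open>The Taylor coefficients of \<open>(1 - x) powr (- a)\<close>.\<close>
definition binom_coeff :: "complex \<Rightarrow> nat \<Rightarrow> complex" where
  "binom_coeff a n = pochhammer a n / fact n"

text \<open>The Taylor coefficients of the Gauss hypergeometric function with upper parameters \<open>1 - a\<close>, \<open>- a\<close>
  and lower parameter \<open>2\<close>.\<close>
definition hyper_coeff :: "complex \<Rightarrow> nat \<Rightarrow> complex" where
  "hyper_coeff a n = pochhammer (1 - a) n * pochhammer (- a) n / (fact n * fact (n + 1))"

lemma binom_coeff_0 [simp]: "binom_coeff a 0 = 1" by (simp add: binom_coeff_def)

lemma hyper_coeff_0 [simp]: "hyper_coeff a 0 = 1" by (simp add: hyper_coeff_def)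

lemma binom_coeff_Suc: "of_nat (n + 1) * binom_coeff a (Suc n) = (a + of_nat n) * binom_coeff a n"
  by (simp add: binom_coeff_def pochhammer_Suc divide_simps del: of_nat_Suc)

lemma hyper_coeff_Suc:
  "of_nat (n + 1) * of_nat (n + 2) * hyper_coeff a (Suc n)
     = (of_nat n + 1 - a) * (of_nat n - a) * hyper_coeff a n"
proof -
  have nz: "of_nat (n + 1) \<noteq> (0 :: complex)" "of_nat (n + 2) \<noteq> (0 :: complex)"
    by (simp_all only: of_nat_eq_0_iff)
  have f: "fact (Suc n) = of_nat (n + 1) * (fact n :: complex)"
    "fact (Suc n + 1) = of_nat (n + 2) * (fact (n + 1) :: complex)"
    by (simp_all add: algebra_simps)
  show ?thesis
    unfolding hyper_coeff_def f pochhammer_Suc using nz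
    by (simp add: divide_simps del: of_nat_Suc of_nat_add)
qed

text \<open>The recursion for the generating polynomials says that \<open>F(x) = (\<Sum>n. G\<^sub>n x\<^sup>n)\<close> satisfies
  \<open>(1 - x)\<^sup>2 (x F)'' = 2 z F\<close>. The exponents of this equation at \<open>x = 1\<close> are \<open>- a\<close> and \<open>a + 1\<close> when
  \<open>2 z = a (a + 1)\<close>. Splitting off the factor \<open>(1 - x) powr (- a)\<close> leaves a hypergeometric equation.\<close>
lemma chain_gf_fps_ode:
  fixes a :: complex
  defines "F \<equiv> Abs_fps (binom_coeff a) * Abs_fps (hyper_coeff a)"
  shows "(1 - fps_X)\<^sup>2 * fps_deriv (fps_deriv (fps_X * F)) = fps_const (a * (a + 1)) * F"
proof -
  define A where "A = Abs_fps (binom_coeff a)"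
  define C where "C = Abs_fps (hyper_coeff a)"
  define \<alpha> where "\<alpha> = fps_const a"
  define A' where "A' = fps_deriv A"
  define A'' where "A'' = fps_deriv A'"
  define C' where "C' = fps_deriv C"
  define C'' where "C'' = fps_deriv C'"
  have A1: "(1 - fps_X) * A' = \<alpha> * A"
  proof (rule fps_ext)
    fix n
    show "fps_nth ((1 - fps_X) * A') n = fps_nth (\<alpha> * A) n"
      using binom_coeff_Suc[of n a] unfolding A'_def A_def \<alpha>_def
      by (cases n) (simp_all add: left_diff_distrib fps_X_mult_nth algebra_simps)
  qed
  have "fps_deriv ((1 - fps_X) * A') = fps_deriv (\<alpha> * A)" using A1 by simp
  then have A2: "(1 - fps_X) * A'' = (\<alpha> + 1) * A'"
    by (simp add: A''_def A'_def \<alpha>_def algebra_simps)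
  have A3: "(1 - fps_X)\<^sup>2 * A'' = \<alpha> * (\<alpha> + 1) * A"
  proof -
    have "(1 - fps_X)\<^sup>2 * A'' = (\<alpha> + 1) * ((1 - fps_X) * A')"
      using arg_cong[OF A2, of "\<lambda>x. (1 - fps_X) * x"] by (simp add: power2_eq_square mult_ac)
    then show ?thesis unfolding A1 by (simp add: mult_ac)
  qed
  have C1: "fps_X * (1 - fps_X) * C'' = - ((2 - 2 * (1 - \<alpha>) * fps_X) * C') - \<alpha> * (1 - \<alpha>) * C"
  proof (rule fps_ext)
    fix n
    have const: "2 * (1 - \<alpha>) = fps_const (2 * (1 - a))" "\<alpha> * (1 - \<alpha>) = fps_const (a * (1 - a))"
      by (simp_all add: \<alpha>_def numeral_fps_const flip: fps_const_1_eq_1)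
    have C'_nth: "fps_nth C' m = of_nat (m + 1) * hyper_coeff a (m + 1)" for m
      by (simp add: C'_def C_def)
    have C''_nth: "fps_nth C'' m = of_nat (m + 1) * of_nat (m + 2) * hyper_coeff a (m + 2)" for m
      by (simp add: C''_def C'_nth mult_ac)
    have l: "fps_X * (1 - fps_X) * C'' = fps_X * C'' - fps_X * (fps_X * C'')"
      by (simp add: algebra_simps)
    have r: "- ((2 - 2 * (1 - \<alpha>) * fps_X) * C') - \<alpha> * (1 - \<alpha>) * C
       = fps_const (2 * (1 - a)) * (fps_X * C') - fps_const 2 * C' - fps_const (a * (1 - a)) * C"
      unfolding const by (simp add: algebra_simps numeral_fps_const)
    show "fps_nth (fps_X * (1 - fps_X) * C'') n = fps_nth (- ((2 - 2 * (1 - \<alpha>) * fps_X) * C') - \<alpha> * (1 - \<alpha>) * C) n"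
    proof (cases n)
      case 0
      then show ?thesis unfolding l r
        using hyper_coeff_Suc[of 0 a] by (simp add: C'_nth C_def algebra_simps)
    next
      case (Suc m)
      have lhs: "fps_nth (fps_X * C'' - fps_X * (fps_X * C'')) n
         = of_nat (m + 1) * of_nat (m + 2) * hyper_coeff a (m + 2) - of_nat m * of_nat (m + 1) * hyper_coeff a (m + 1)"
        by (cases m) (simp_all add: Suc fps_X_mult_nth C''_nth)
      have "of_nat (m + 2) * of_nat (m + 3) * hyper_coeff a (m + 2)
          = (of_nat m + 2 - a) * (of_nat m + 1 - a) * hyper_coeff a (m + 1)"
        using hyper_coeff_Suc[of "m + 1" a] by (simp add: add_ac)
      moreover have rhs: "fps_nth (fps_const (2 * (1 - a)) * (fps_X * C') - fps_const 2 * C' - fps_const (a * (1 - a)) * C) n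
        = 2 * (1 - a) * (of_nat (m + 1) * hyper_coeff a (m + 1)) - 2 * (of_nat (m + 2) * hyper_coeff a (m + 2))
          - a * (1 - a) * hyper_coeff a (m + 1)"
        unfolding fps_sub_nth fps_mult_left_const_nth by (simp add: Suc C'_nth C_def)
      ultimately show ?thesis unfolding l r lhs rhs
        by (simp add: algebra_simps)
    qed
  qed
  have F2: "fps_deriv (fps_deriv (fps_X * (A * C)))
      = 2 * (A' * C + A * C') + fps_X * (A'' * C + 2 * A' * C' + A * C'')"
    by (simp add: A''_def A'_def C''_def C'_def algebra_simps)
  have "(1 - fps_X)\<^sup>2 * (2 * (A' * C + A * C') + fps_X * (A'' * C + 2 * A' * C' + A * C''))
     = 2 * (1 - fps_X) * C * ((1 - fps_X) * A') + 2 * (1 - fps_X)\<^sup>2 * A * C'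
       + fps_X * C * ((1 - fps_X)\<^sup>2 * A'') + 2 * fps_X * (1 - fps_X) * C' * ((1 - fps_X) * A')
       + (1 - fps_X) * A * (fps_X * (1 - fps_X) * C'')"
    by (simp add: algebra_simps power2_eq_square)
  also have "\<dots> = \<alpha> * (\<alpha> + 1) * (A * C)"
    unfolding A1 A3 C1 by (simp add: algebra_simps power2_eq_square)
  also have "\<alpha> * (\<alpha> + 1) = fps_const (a * (a + 1))"
    unfolding \<alpha>_def by (simp add: fps_const_mult[symmetric] fps_const_add[symmetric] del: fps_const_mult fps_const_add)
  finally show ?thesis unfolding F_def A_def[symmetric] C_def[symmetric] F2 .
qed

lemma fps_geometric_square:
  "(1 - fps_X)\<^sup>2 * Abs_fps (\<lambda>k. of_nat (k + 1)) = (1 :: complex fps)"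
proof (rule fps_ext)
  fix n
  show "fps_nth ((1 - fps_X)\<^sup>2 * Abs_fps (\<lambda>k. of_nat (k + 1))) n = fps_nth (1 :: complex fps) n"
  proof -
    have "(1 - fps_X)\<^sup>2 * Abs_fps (\<lambda>k. of_nat (k + 1)) = Abs_fps (\<lambda>k. of_nat (k + 1))
      - fps_X * Abs_fps (\<lambda>k. of_nat (k + 1)) - fps_X * Abs_fps (\<lambda>k. of_nat (k + 1))
      + fps_X * (fps_X * Abs_fps (\<lambda>k. of_nat (k + 1) :: complex))"
      by (simp add: power2_eq_square algebra_simps)
    then show ?thesis
      by (cases n; cases "n - 1") (auto simp: fps_X_mult_nth)
  qed
qed

text \<open>Dividing the differential equation by \<open>(1 - x)\<^sup>2\<close>, that is, multiplying by the series with
  coefficients \<open>k + 1\<close>, gives back the recursion, and the recursion has only one solution starting at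
  \<open>1\<close>.\<close>
lemma chain_gf_eq_convolution:
  fixes a z :: complex
  assumes "2 * z = a * (a + 1)"
  shows "chain_gf n z = (\<Sum>k\<le>n. binom_coeff a (n - k) * hyper_coeff a k)"
proof -
  define F where "F = Abs_fps (binom_coeff a) * Abs_fps (hyper_coeff a)"
  define D where "D = Abs_fps (\<lambda>k. of_nat (k + 1) :: complex)"
  define D2 where "D2 = fps_deriv (fps_deriv (fps_X * F))"
  have "D2 = ((1 - fps_X)\<^sup>2 * D) * D2"
    unfolding D_def fps_geometric_square by simp
  also have "\<dots> = D * ((1 - fps_X)\<^sup>2 * D2)" by (simp only: mult_ac)
  also have "\<dots> = fps_const (2 * z) * (F * D)"
    unfolding D2_def F_def chain_gf_fps_ode assms by (simp only: mult_ac)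
  finally have ode: "D2 = fps_const (2 * z) * (F * D)" .
  have rec: "of_nat (n + 1) * of_nat (n + 2) * fps_nth F (Suc n) = 2 * z * (\<Sum>k\<le>n. of_nat (n + 1 - k) * fps_nth F k)" for n
  proof -
    have "fps_nth D2 n = of_nat (n + 1) * of_nat (n + 2) * fps_nth F (Suc n)"
      unfolding D2_def fps_deriv_nth by (simp add: mult_ac)
    moreover have "fps_nth (F * D) n = (\<Sum>k\<le>n. of_nat (n + 1 - k) * fps_nth F k)"
      unfolding fps_mult_nth D_def atMost_atLeast0
      by (intro sum.cong) (auto simp: Suc_diff_le mult.commute)
    ultimately show ?thesis using arg_cong[OF ode, of "\<lambda>f. fps_nth f n"] by simp
  qed
  have "chain_gf n z = fps_nth F n"
  proof (induction n rule: less_induct)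
    case (less n)
    show ?case
    proof (cases n)
      case 0
      then show ?thesis by (simp add: F_def)
    next
      case (Suc m)
      have nz: "of_nat (m + 1) * of_nat (m + 2) \<noteq> (0 :: complex)"
        by (simp only: of_nat_mult[symmetric] of_nat_eq_0_iff) simp
      have "chain_gf n z = 2 * z / (of_nat (m + 1) * of_nat (m + 2)) * (\<Sum>k\<le>m. of_nat (m + 1 - k) * fps_nth F k)"
        unfolding Suc chain_gf_Suc using less Suc
        by (intro arg_cong2[where f = "(*)"] sum.cong refl) (auto simp: less_Suc_eq_le)
      also have "\<dots> = fps_nth F n" using rec[of m] nz unfolding Suc by (simp add: field_simps del: of_nat_add)
      finally show ?thesis .
    qed
  qed
  also have "fps_nth F n = fps_nth (Abs_fps (hyper_coeff a) * Abs_fps (binom_coeff a)) n" by (simp add: F_def mult.commute)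
  also have "\<dots> = (\<Sum>k\<le>n. binom_coeff a (n - k) * hyper_coeff a k)"
    unfolding fps_mult_nth atMost_atLeast0 by (simp add: mult.commute)
  finally show ?thesis .
qed

lemma binom_coeff_nz:
  assumes "norm (a - 1) \<le> 1 / 4" shows "binom_coeff a n \<noteq> 0"
proof -
  have "norm (a + of_nat k) \<ge> 3 / 4" for k
  proof -
    have "norm (of_nat (k + 1) :: complex) \<le> norm (a + of_nat k) + norm (a - 1)"
      using norm_triangle_ineq4[of "a + of_nat k" "a - 1"] by (simp add: algebra_simps)
    then show ?thesis using assms unfolding norm_of_nat by simp
  qed
  then have "a + of_nat k \<noteq> 0" for k by (metis norm_zero not_less zero_less_divide_iff zero_less_numeral)
  then show ?thesis
    unfolding binom_coeff_def by (auto simp: pochhammer_eq_0_iff) (metis add.commute add.right_inverse)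
qed

section \<open>Comparison with a binomial coefficient\<close>

text \<open>Passing from \<open>m + k\<close> down to \<open>m\<close> divides by \<open>k\<close> factors of the form \<open>(a + i) / (i + 1)\<close> with
  \<open>m \<le> i\<close>. Their moduli are at least \<open>(i + 3 / 4) / (i + 1)\<close>, which increases with \<open>i\<close>; so the
  estimate is weakest for \<open>m = 0\<close>, and that case bounds the others.\<close>
lemma norm_binom_coeff_shift_le:
  assumes a: "norm (a - 1) \<le> 1 / 4"
  shows "norm (binom_coeff a m) \<le> (\<Prod>j<k. real (j + 1) / (real j + 3 / 4)) * norm (binom_coeff a (m + k))"
proof (induction k)
  case (Suc k)
  let ?i = "m + k"
  have lb: "real ?i + 3 / 4 \<le> norm (a + of_nat ?i)"
  proof -
    have "norm (of_nat (?i + 1) :: complex) \<le> norm (a + of_nat ?i) + norm (a - 1)"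
      using norm_triangle_ineq4[of "a + of_nat ?i" "a - 1"] by (simp add: algebra_simps)
    then show ?thesis using a unfolding norm_of_nat by simp
  qed
  have "real (?i + 1) * norm (binom_coeff a (Suc ?i)) = norm (a + of_nat ?i) * norm (binom_coeff a ?i)"
    using arg_cong[OF binom_coeff_Suc[of ?i a], of norm] unfolding norm_mult norm_of_nat .
  then have "(real ?i + 3 / 4) * norm (binom_coeff a ?i) \<le> real (?i + 1) * norm (binom_coeff a (Suc ?i))"
    using mult_right_mono[OF lb norm_ge_zero] by metis
  then have "norm (binom_coeff a ?i) \<le> real (?i + 1) / (real ?i + 3 / 4) * norm (binom_coeff a (Suc ?i))"
    by (simp add: field_simps)
  also have "\<dots> \<le> real (k + 1) / (real k + 3 / 4) * norm (binom_coeff a (Suc ?i))"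
    by (intro mult_right_mono) (auto simp: divide_simps algebra_simps)
  finally have step: "norm (binom_coeff a ?i) \<le> real (k + 1) / (real k + 3 / 4) * norm (binom_coeff a (Suc ?i))" .
  have "norm (binom_coeff a m) \<le> (\<Prod>j<k. real (j + 1) / (real j + 3 / 4)) * norm (binom_coeff a ?i)"
    by (rule Suc.IH)
  also have "\<dots> \<le> (\<Prod>j<k. real (j + 1) / (real j + 3 / 4)) * (real (k + 1) / (real k + 3 / 4) * norm (binom_coeff a (Suc ?i)))"
    by (intro mult_left_mono step prod_nonneg) auto
  finally show ?case by (simp add: mult.assoc)
qed simp

text \<open>The hypergeometric coefficients are small because \<open>1 - a\<close> is one of the upper parameters. They
  decay so fast that even after multiplication with the largest possible ratio of binomial
  coefficients they are dominated by a telescoping series of sum \<open>5 / 12\<close>. The exact bounds matter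
  little; what is needed is a sum below \<open>1 / 2\<close>.\<close>
lemma norm_hyper_coeff_le:
  assumes a: "norm (a - 1) \<le> 1 / 4"
  shows "norm (hyper_coeff a (Suc k)) * (\<Prod>j<Suc k. real (j + 1) / (real j + 3 / 4))
     \<le> 5 / 12 * (1 / real (k + 1) - 1 / real (k + 2))"
proof (induction k)
  case 0
  have e: "2 * hyper_coeff a 1 = (1 - a) * (- a)" using hyper_coeff_Suc[of 0 a] by simp
  have "2 * norm (hyper_coeff a 1) = norm (1 - a) * norm a"
    using arg_cong[OF e, of norm] unfolding norm_mult norm_minus_cancel by simp
  moreover have "norm (1 - a) \<le> 1 / 4" using a by (simp add: norm_minus_commute)
  moreover have "norm a \<le> 5 / 4" using a norm_triangle_ineq[of "a - 1" 1] by simp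
  moreover from calculation(2,3) have "norm (1 - a) * norm a \<le> 1 / 4 * (5 / 4)"
    by (intro mult_mono) auto
  ultimately have "norm (hyper_coeff a 1) \<le> 1 / 4 * (5 / 4) / 2" by linarith
  then show ?case by simp
next
  case (Suc k)
  define p where "p = (\<Prod>j<Suc k. real (j + 1) / (real j + 3 / 4))"
  have p: "0 \<le> p" unfolding p_def by (intro prod_nonneg) auto
  have n1: "norm (of_nat (k + 1) + 1 - a) \<le> real (k + 1) + 1 / 4"
    using norm_triangle_ineq4[of "of_nat (k + 1)" "a - 1"] a
    unfolding norm_of_nat by (simp add: algebra_simps)
  have n2: "norm (of_nat (k + 1) - a) \<le> real (k + 1) - 3 / 4"
    using norm_triangle_ineq4[of "of_nat k" "a - 1"] a
    unfolding norm_of_nat by (simp add: algebra_simps)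
  have eq: "real (k + 2) * real (k + 3) * norm (hyper_coeff a (Suc (Suc k)))
     = norm (of_nat (k + 1) + 1 - a) * norm (of_nat (k + 1) - a) * norm (hyper_coeff a (Suc k))"
    using arg_cong[OF hyper_coeff_Suc[of "Suc k" a], of norm] unfolding norm_mult norm_of_nat
    by (simp add: norm_mult add_ac)
  have n12: "norm (of_nat (k + 1) + 1 - a) * norm (of_nat (k + 1) - a) \<le> (real (k + 1) + 3 / 4) * real (k + 1)"
  proof -
    have "norm (of_nat (k + 1) + 1 - a) * norm (of_nat (k + 1) - a) \<le> (real (k + 1) + 1 / 4) * (real (k + 1) - 3 / 4)"
      by (intro mult_mono n1 n2) auto
    also have "\<dots> \<le> (real (k + 1) + 3 / 4) * real (k + 1)" by (intro mult_mono) auto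
    finally show ?thesis .
  qed
  have "real (k + 3) * (norm (hyper_coeff a (Suc (Suc k))) * (\<Prod>j<Suc (Suc k). real (j + 1) / (real j + 3 / 4)))
    = (real (k + 2) * real (k + 3) * norm (hyper_coeff a (Suc (Suc k)))) * p / (real (k + 1) + 3 / 4)"
    unfolding prod.lessThan_Suc[of _ "Suc k"] p_def[symmetric] by (simp add: mult_ac)
  also have "\<dots> = norm (of_nat (k + 1) + 1 - a) * norm (of_nat (k + 1) - a) * (norm (hyper_coeff a (Suc k)) * p) / (real (k + 1) + 3 / 4)"
    unfolding eq by (simp add: mult_ac)
  also have "\<dots> \<le> (real (k + 1) + 3 / 4) * real (k + 1) * (norm (hyper_coeff a (Suc k)) * p) / (real (k + 1) + 3 / 4)"
    by (intro divide_right_mono mult_right_mono n12) (auto simp: p)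
  also have "\<dots> = real (k + 1) * (norm (hyper_coeff a (Suc k)) * p)" by simp
  also have "\<dots> \<le> real (k + 1) * (5 / 12 * (1 / real (k + 1) - 1 / real (k + 2)))"
    using Suc.IH unfolding p_def by (intro mult_left_mono) auto
  also have "\<dots> = real (k + 3) * (5 / 12 * (1 / real (Suc k + 1) - 1 / real (Suc k + 2)))"
    by (simp add: divide_simps) (simp add: algebra_simps)
  finally show ?case by (rule mult_left_le_imp_le) simp
qed

text \<open>The term with \<open>k = 0\<close> of the convolution dominates all others together, uniformly in \<open>n\<close>. No limit
  \<open>n \<longlonglongrightarrow> \<infinity>\<close> is taken: a bounded relative error is enough, since it changes the logarithm by a bounded
  amount.\<close>
lemma chain_gf_near_binom_coeff:
  assumes a: "norm (a - 1) \<le> 1 / 4" and z: "2 * z = a * (a + 1)"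
  shows "norm (chain_gf n z - binom_coeff a n) \<le> 5 / 12 * norm (binom_coeff a n)"
proof -
  have "chain_gf n z = binom_coeff a n + (\<Sum>k<n. binom_coeff a (n - Suc k) * hyper_coeff a (Suc k))"
    unfolding chain_gf_eq_convolution[OF z] by (subst sum.atMost_shift) simp
  then have "norm (chain_gf n z - binom_coeff a n) = norm (\<Sum>k<n. binom_coeff a (n - Suc k) * hyper_coeff a (Suc k))"
    by simp
  also have "\<dots> \<le> (\<Sum>k<n. norm (binom_coeff a (n - Suc k)) * norm (hyper_coeff a (Suc k)))"
    unfolding norm_mult[symmetric] by (rule norm_sum)
  also have "\<dots> \<le> (\<Sum>k<n. 5 / 12 * norm (binom_coeff a n) * (1 / real (k + 1) - 1 / real (k + 2)))"
  proof (rule sum_mono)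
    fix k assume "k \<in> {..<n}"
    then have "norm (binom_coeff a (n - Suc k)) \<le> (\<Prod>j<Suc k. real (j + 1) / (real j + 3 / 4)) * norm (binom_coeff a n)"
      using norm_binom_coeff_shift_le[OF a, of "n - Suc k" "Suc k"] by simp
    then have "norm (binom_coeff a (n - Suc k)) * norm (hyper_coeff a (Suc k))
       \<le> (\<Prod>j<Suc k. real (j + 1) / (real j + 3 / 4)) * norm (binom_coeff a n) * norm (hyper_coeff a (Suc k))"
      by (rule mult_right_mono) simp
    also have "\<dots> = norm (binom_coeff a n) * (norm (hyper_coeff a (Suc k)) * (\<Prod>j<Suc k. real (j + 1) / (real j + 3 / 4)))"
      by (simp only: mult_ac)
    also have "\<dots> \<le> norm (binom_coeff a n) * (5 / 12 * (1 / real (k + 1) - 1 / real (k + 2)))"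
      by (intro mult_left_mono norm_hyper_coeff_le a) simp
    finally show "norm (binom_coeff a (n - Suc k)) * norm (hyper_coeff a (Suc k))
       \<le> 5 / 12 * norm (binom_coeff a n) * (1 / real (k + 1) - 1 / real (k + 2))" by (simp only: mult_ac)
  qed
  also have "\<dots> = 5 / 12 * norm (binom_coeff a n) * (\<Sum>k<n. 1 / real (k + 1) - 1 / real (k + 2))"
    by (simp add: sum_distrib_left)
  also have "(\<Sum>k<n. 1 / real (k + 1) - 1 / real (k + 2)) = 1 - 1 / real (n + 1)"
    using sum_lessThan_telescope'[of "\<lambda>k. 1 / real (k + 1)" n] by (simp add: add_ac)
  also have "5 / 12 * norm (binom_coeff a n) * (1 - 1 / real (n + 1)) \<le> 5 / 12 * norm (binom_coeff a n) * 1"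
    by (intro mult_left_mono) auto
  finally show ?thesis by simp
qed

section \<open>Derivatives of the logarithm\<close>

text \<open>Cumulants are derivatives along the real line; this identifies them with complex derivatives, to
  which Cauchy's inequality applies.\<close>
lemma higher_deriv_of_real:
  fixes f :: "real \<Rightarrow> real" and fc :: "complex \<Rightarrow> complex"
  assumes hol: "fc holomorphic_on ball 0 \<rho>"
    and eq: "\<And>t. \<bar>t\<bar> < \<rho> \<Longrightarrow> fc (of_real t) = of_real (f t)"
    and t: "\<bar>t\<bar> < \<rho>"
  shows "(deriv ^^ r) fc (of_real t) = of_real ((deriv ^^ r) f t)"
  using t
proof (induction r arbitrary: t)
  case 0
  then show ?case using eq by simp
next
  case (Suc r)
  define g where "g = (deriv ^^ r) fc"
  define h where "h = (deriv ^^ r) f"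
  have "(g has_field_derivative deriv g (of_real t)) (at (of_real t))"
    unfolding g_def using hol Suc.prems
    by (intro holomorphic_derivI[of _ "ball 0 \<rho>"] holomorphic_higher_deriv) auto
  then have v: "((\<lambda>s. g (of_real s)) has_vector_derivative deriv g (of_real t)) (at t)"
    by (rule has_vector_derivative_real_field)
  have v': "((\<lambda>s. complex_of_real (h s)) has_vector_derivative deriv g (of_real t)) (at t)"
  proof (rule has_vector_derivative_transform_within_open[OF v])
    show "open {-\<rho><..<\<rho>}" by simp
    show "t \<in> {-\<rho><..<\<rho>}" using Suc.prems by auto
    show "g (of_real s) = of_real (h s)" if "s \<in> {-\<rho><..<\<rho>}" for s
      using Suc.IH[of s] that by (auto simp: g_def h_def abs_less_iff)
  qed
  have re: "(h has_vector_derivative Re (deriv g (of_real t))) (at t)"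
    using bounded_linear.has_vector_derivative[OF bounded_linear_Re v'] by simp
  have "((\<lambda>s. 0 :: real) has_vector_derivative Im (deriv g (of_real t))) (at t)"
    using bounded_linear.has_vector_derivative[OF bounded_linear_Im v'] by simp
  then have im: "Im (deriv g (of_real t)) = 0"
    using has_vector_derivative_const vector_derivative_unique_at by blast
  have "deriv h t = Re (deriv g (of_real t))"
    using re by (intro DERIV_imp_deriv) (simp add: has_real_derivative_iff_has_vector_derivative)
  then show ?case using im by (simp add: g_def h_def complex_eq_iff)
qed

text \<open>The complex continuation of \<open>\<mu>\<close>.\<close>
definition cmu :: "complex \<Rightarrow> complex" where
  "cmu t = (csqrt (8 * exp t + 1) - 1) / 2 - 1"

lemma cmu_of_real: "cmu (of_real t) = of_real (\<mu> t)"
proof -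
  have "csqrt (8 * exp (of_real t) + 1) = of_real (sqrt (8 * exp t + 1))"
  proof -
    have "8 * exp (complex_of_real t) + 1 = of_real (8 * exp t + 1)" by (simp add: exp_of_real)
    then show ?thesis by (simp only: csqrt_of_real_nonneg Im_complex_of_real Re_complex_of_real add_nonneg_nonneg
      exp_ge_zero mult_nonneg_nonneg zero_le_numeral zero_le_one)
  qed
  then show ?thesis by (simp add: cmu_def \<mu>_def)
qed

text \<open>So \<open>a = 1 + cmu t\<close> is the parameter that belongs to \<open>z = exp t\<close>.\<close>
lemma cmu_quadratic: "2 * exp t = (1 + cmu t) * (1 + cmu t + 1)"
proof -
  have "(csqrt (8 * exp t + 1))\<^sup>2 = 8 * exp t + 1" by simp
  then show ?thesis unfolding cmu_def by (simp add: field_simps power2_eq_square)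
qed

text \<open>The disc on which everything takes place: the root has no branch point there, and
  \<open>a = 1 + cmu t\<close> stays in the range in which \<open>chain_gf n\<close> is compared with a binomial coefficient.\<close>
lemma cmu_small_ball:
  obtains \<rho> where "0 < \<rho>" "cmu holomorphic_on ball 0 \<rho>" "\<And>t. t \<in> ball 0 \<rho> \<Longrightarrow> norm (cmu t) \<le> 1 / 4"
proof -
  have "continuous (at 0) (\<lambda>t. 8 * exp t + 1 :: complex)" by (intro continuous_intros)
  then obtain \<rho>1 where "0 < \<rho>1" "\<forall>t. norm (t - 0) < \<rho>1 \<longrightarrow> norm ((8 * exp t + 1) - (8 * exp 0 + 1) :: complex) < 1"
    unfolding continuous_at_eps_delta dist_norm using zero_less_one by blast
  then have \<rho>1: "0 < \<rho>1" "\<And>t. norm t < \<rho>1 \<Longrightarrow> norm ((8 * exp t + 1) - 9 :: complex) < 1"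
    by simp_all
  have nonpos: "8 * exp t + 1 \<notin> \<real>\<^sub>\<le>\<^sub>0" if "norm t < \<rho>1" for t :: complex
  proof -
    have "\<bar>Re ((8 * exp t + 1) - 9)\<bar> < 1"
      using \<rho>1(2)[OF that] abs_Re_le_cmod[of "(8 * exp t + 1) - 9"] by linarith
    then have "0 < Re (8 * exp t + 1)" by simp
    then show ?thesis by (auto simp: complex_nonpos_Reals_iff)
  qed
  have hol: "cmu holomorphic_on ball 0 \<rho>1"
    unfolding cmu_def by (intro holomorphic_intros) (use nonpos in \<open>auto simp: dist_norm\<close>)
  have "cmu 0 = 0" using cmu_of_real[of 0] by (simp add: \<mu>_def)
  moreover have "continuous (at 0) cmu"
    using holomorphic_on_imp_continuous_on[OF hol] \<rho>1(1)
    by (simp add: continuous_on_eq_continuous_at)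
  moreover have "(0 :: real) < 1 / 4" by simp
  ultimately obtain \<rho>2 where "0 < \<rho>2" "\<forall>t. norm (t - 0) < \<rho>2 \<longrightarrow> norm (cmu t - cmu 0) < 1 / 4"
    unfolding continuous_at_eps_delta dist_norm by blast
  with \<open>cmu 0 = 0\<close> have \<rho>2: "0 < \<rho>2" "\<And>t. norm t < \<rho>2 \<Longrightarrow> norm (cmu t) < 1 / 4"
    by simp_all
  show ?thesis
  proof
    show "0 < min \<rho>1 \<rho>2" using \<rho>1 \<rho>2 by simp
    show "cmu holomorphic_on ball 0 (min \<rho>1 \<rho>2)" by (rule holomorphic_on_subset[OF hol]) auto
    show "norm (cmu t) \<le> 1 / 4" if "t \<in> ball 0 (min \<rho>1 \<rho>2)" for t
      using \<rho>2(2)[of t] that by (simp add: dist_norm)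
  qed
qed

text \<open>In this form the logarithm is a sum of the terms \<open>Ln (1 + m / (j + 1))\<close>, close to \<open>m\<close> times a
  harmonic number.\<close>
lemma binom_coeff_eq_prod: "binom_coeff (1 + m) n = (\<Prod>j<n. 1 + m / of_nat (j + 1))"
proof (induction n)
  case (Suc n)
  have "of_nat (n + 1) \<noteq> (0 :: complex)" by (simp only: of_nat_eq_0_iff)
  moreover have "of_nat (n + 1) * binom_coeff (1 + m) (Suc n) = (of_nat (n + 1) + m) * binom_coeff (1 + m) n"
    using binom_coeff_Suc[of n "1 + m"] by (simp add: add_ac)
  ultimately have "binom_coeff (1 + m) (Suc n) = (1 + m / of_nat (n + 1)) * binom_coeff (1 + m) n"
    by (simp add: divide_simps del: of_nat_Suc of_nat_add) (simp add: algebra_simps)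
  then show ?case using Suc.IH by (simp add: mult.commute)
qed simp

text \<open>The logarithm of the moment generating function minus \<open>harm n * cmu t\<close>. It is written as a sum of
  principal logarithms of numbers near \<open>1\<close>, so that it is holomorphic and can be bounded term by term.\<close>
definition log_remainder :: "nat \<Rightarrow> complex \<Rightarrow> complex" where
  "log_remainder n t = 2 * t + (\<Sum>j<n. Ln (1 + cmu t / of_nat (j + 1)) - cmu t / of_nat (j + 1))
     + Ln (1 + (chain_gf n (exp t) - binom_coeff (1 + cmu t) n) / binom_coeff (1 + cmu t) n)"

lemma norm_ratio_le:
  assumes "norm (cmu t) \<le> 1 / 4"
  shows "norm ((chain_gf n (exp t) - binom_coeff (1 + cmu t) n) / binom_coeff (1 + cmu t) n) \<le> 5 / 12"
    and "binom_coeff (1 + cmu t) n \<noteq> 0"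
proof -
  have a: "norm (1 + cmu t - 1) \<le> 1 / 4" using assms by simp
  show nz: "binom_coeff (1 + cmu t) n \<noteq> 0" by (rule binom_coeff_nz[OF a])
  show "norm ((chain_gf n (exp t) - binom_coeff (1 + cmu t) n) / binom_coeff (1 + cmu t) n) \<le> 5 / 12"
    using chain_gf_near_binom_coeff[OF a cmu_quadratic, of n] nz by (simp add: norm_divide divide_le_eq)
qed

lemma norm_div_Suc_le:
  assumes "norm (w :: complex) \<le> 1 / 4" shows "norm (w / of_nat (j + 1)) \<le> 1 / 4"
proof -
  have "norm (w / of_nat (j + 1)) = norm w / real (j + 1)" unfolding norm_divide norm_of_nat ..
  also have "\<dots> \<le> norm w / 1" by (intro divide_left_mono) auto
  finally show ?thesis using assms by simp
qed

lemma one_plus_notin_nonpos_Reals: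
  assumes "norm (w :: complex) < 1" shows "0 < Re (1 + w)" "1 + w \<notin> \<real>\<^sub>\<le>\<^sub>0" "1 + w \<noteq> 0"
proof -
  show 1: "0 < Re (1 + w)" using abs_Re_le_cmod[of w] assms by simp
  then show "1 + w \<notin> \<real>\<^sub>\<le>\<^sub>0" by (auto simp: complex_nonpos_Reals_iff)
  show "1 + w \<noteq> 0" using 1 by force
qed

lemma holomorphic_log_remainder:
  assumes hol: "cmu holomorphic_on ball 0 \<rho>" and small: "\<And>t. t \<in> ball 0 \<rho> \<Longrightarrow> norm (cmu t) \<le> 1 / 4"
  shows "log_remainder n holomorphic_on ball 0 \<rho>"
proof -
  have 1: "1 + cmu t / of_nat (j + 1) \<notin> \<real>\<^sub>\<le>\<^sub>0" if "t \<in> ball 0 \<rho>" for t j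
    using norm_div_Suc_le[OF small[OF that], of j] by (intro one_plus_notin_nonpos_Reals) simp
  have 2: "1 + (chain_gf n (exp t) - binom_coeff (1 + cmu t) n) / binom_coeff (1 + cmu t) n \<notin> \<real>\<^sub>\<le>\<^sub>0"
    if "t \<in> ball 0 \<rho>" for t
    using norm_ratio_le(1)[OF small[OF that], of n] by (intro one_plus_notin_nonpos_Reals) simp
  have 3: "(\<lambda>t. binom_coeff (1 + cmu t) n) holomorphic_on ball 0 \<rho>"
    unfolding binom_coeff_eq_prod by (intro holomorphic_intros hol) (simp del: of_nat_add)
  show ?thesis
    unfolding log_remainder_def
    by (intro holomorphic_intros hol 3) (use 1 2 norm_ratio_le(2)[OF small] in \<open>auto simp del: of_nat_add\<close>)
qed

lemma sum_inverse_squares_le: "(\<Sum>j<n. 1 / (real (j + 1))\<^sup>2) \<le> 2"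
proof -
  have "(\<Sum>j<n. 1 / (real (j + 1))\<^sup>2) \<le> (\<Sum>j<n. 2 * (1 / real (j + 1) - 1 / real (j + 2)))"
  proof (rule sum_mono)
    fix j
    have "1 / (real (j + 1))\<^sup>2 = 2 / (2 * (real (j + 1))\<^sup>2)" by simp
    also have "\<dots> \<le> 2 / (real (j + 1) * real (j + 2))"
    proof (rule divide_left_mono)
      show "real (j + 1) * real (j + 2) \<le> 2 * (real (j + 1))\<^sup>2"
        by (simp add: power2_eq_square algebra_simps)
      show "0 < 2 * (real (j + 1))\<^sup>2 * (real (j + 1) * real (j + 2))"
        by (intro mult_pos_pos zero_less_power) simp_all
    qed simp
    also have "\<dots> = 2 * (1 / real (j + 1) - 1 / real (j + 2))" by (simp add: divide_simps)
    finally show "1 / (real (j + 1))\<^sup>2 \<le> 2 * (1 / real (j + 1) - 1 / real (j + 2))" .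
  qed
  also have "\<dots> = 2 * (1 - 1 / real (n + 1))"
    unfolding sum_distrib_left[symmetric]
    using sum_lessThan_telescope'[of "\<lambda>k. 1 / real (k + 1)" n] by (simp add: add_ac)
  also have "\<dots> \<le> 2" by simp
  finally show ?thesis .
qed

text \<open>The bound is uniform in \<open>n\<close>: the sum is dominated by the inverse squares, and the last logarithm is
  that of a number at distance at most \<open>5 / 12\<close> from \<open>1\<close>.\<close>
lemma norm_log_remainder_le:
  assumes "norm (cmu t) \<le> 1 / 4"
  shows "norm (log_remainder n t) \<le> 2 * norm t + 2"
proof -
  let ?w = "\<lambda>j. cmu t / of_nat (j + 1)"
  let ?E = "(chain_gf n (exp t) - binom_coeff (1 + cmu t) n) / binom_coeff (1 + cmu t) n"
  have "norm (Ln (1 + ?w j) - ?w j) \<le> 1 / 2 * (1 / (real (j + 1))\<^sup>2)" for j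
  proof -
    have w: "norm (?w j) \<le> 1 / 4" by (rule norm_div_Suc_le[OF assms])
    have "norm (Ln (1 + ?w j) - ?w j) \<le> (norm (?w j))\<^sup>2 / (1 - norm (?w j))"
      using w by (intro Ln_approx_linear) simp
    also have "\<dots> \<le> (norm (?w j))\<^sup>2 / (1 / 2)" using w by (intro divide_left_mono) auto
    also have "(norm (?w j))\<^sup>2 = (norm (cmu t))\<^sup>2 / (real (j + 1))\<^sup>2"
      unfolding norm_divide norm_of_nat power_divide ..
    also have "(norm (cmu t))\<^sup>2 / (real (j + 1))\<^sup>2 / (1 / 2) \<le> (1 / 4)\<^sup>2 / (real (j + 1))\<^sup>2 / (1 / 2)"
      using assms by (intro divide_right_mono power_mono) auto
    also have "\<dots> = 1 / 8 * (1 / (real (j + 1))\<^sup>2)" by (simp add: power2_eq_square)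
    also have "\<dots> \<le> 1 / 2 * (1 / (real (j + 1))\<^sup>2)" by (intro mult_right_mono) auto
    finally show ?thesis .
  qed
  then have "(\<Sum>j<n. norm (Ln (1 + ?w j) - ?w j)) \<le> 1 / 2 * (\<Sum>j<n. 1 / (real (j + 1))\<^sup>2)"
    unfolding sum_distrib_left by (intro sum_mono)
  then have s: "norm (\<Sum>j<n. Ln (1 + ?w j) - ?w j) \<le> 1"
    using norm_sum[of "\<lambda>j. Ln (1 + ?w j) - ?w j" "{..<n}"] sum_inverse_squares_le[of n] by linarith
  have "norm (Ln (1 + ?E)) \<le> 2 * norm ?E"
    using norm_ratio_le(1)[OF assms, of n] by (intro norm_Ln_le) simp
  then have e: "norm (Ln (1 + ?E)) \<le> 1" using norm_ratio_le(1)[OF assms, of n] by linarith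
  have "norm (log_remainder n t) \<le> norm (2 * t) + norm (\<Sum>j<n. Ln (1 + ?w j) - ?w j) + norm (Ln (1 + ?E))"
    unfolding log_remainder_def by (intro norm_triangle_le add_mono norm_triangle_ineq order_refl)
  then show ?thesis using s e by (simp add: norm_mult)
qed

lemma exp_log_remainder:
  assumes "norm (cmu t) \<le> 1 / 4"
  shows "exp (of_real (harm n) * cmu t + log_remainder n t) = (exp t)\<^sup>2 * chain_gf n (exp t)"
proof -
  let ?w = "\<lambda>j. cmu t / of_nat (j + 1)"
  let ?P = "binom_coeff (1 + cmu t) n"
  let ?E = "(chain_gf n (exp t) - ?P) / ?P"
  have "of_real (harm n) * cmu t = (\<Sum>j<n. ?w j)"
  proof (induction n)
    case (Suc n)
    have "of_real (harm (Suc n)) * cmu t = of_real (harm n) * cmu t + cmu t / of_nat (n + 1)"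
      by (simp add: harm_Suc distrib_right divide_inverse mult.commute[of _ "cmu t"] distrib_left)
    then show ?case using Suc.IH by (simp only: sum.lessThan_Suc)
  qed (simp add: harm_expand(1))
  then have "of_real (harm n) * cmu t + log_remainder n t
     = 2 * t + (\<Sum>j<n. Ln (1 + ?w j)) + Ln (1 + ?E)"
    unfolding log_remainder_def by (simp add: sum_subtractf)
  then have "exp (of_real (harm n) * cmu t + log_remainder n t) = exp (2 * t) * (\<Prod>j<n. exp (Ln (1 + ?w j))) * exp (Ln (1 + ?E))"
    by (simp only: exp_add exp_sum[OF finite_lessThan])
  also have "(\<Prod>j<n. exp (Ln (1 + ?w j))) = ?P"
    unfolding binom_coeff_eq_prod
  proof (intro prod.cong refl exp_Ln)
    fix j show "1 + ?w j \<noteq> 0"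
      using norm_div_Suc_le[OF assms, of j] by (intro one_plus_notin_nonpos_Reals) simp
  qed
  also have "exp (Ln (1 + ?E)) = 1 + ?E"
    using norm_ratio_le(1)[OF assms, of n] by (intro exp_Ln one_plus_notin_nonpos_Reals) simp
  also have "exp (2 * t) * ?P * (1 + ?E) = (exp t)\<^sup>2 * chain_gf n (exp t)"
    using norm_ratio_le(2)[OF assms, of n] unfolding exp_double by (simp add: field_simps)
  finally show ?thesis .
qed

lemma log_remainder_of_real:
  assumes small: "norm (cmu (of_real t)) \<le> 1 / 4"
  shows "of_real (harm n) * cmu (of_real t) + log_remainder n (of_real t)
     = of_real (2 * t + ln (chain_gf n (exp t)))"
proof -
  let ?t = "complex_of_real t"
  let ?\<Lambda> = "of_real (harm n) * cmu ?t + log_remainder n ?t"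
  have P: "binom_coeff (1 + cmu ?t) n \<in> \<real>"
    unfolding binom_coeff_eq_prod cmu_of_real by (intro prod_in_Reals Reals_add Reals_divide) auto
  have c: "chain_gf n (exp ?t) \<in> \<real>" using chain_gf_of_real[of n "exp t"] by (metis Reals_of_real exp_of_real)
  have Ln_real: "Ln (1 + w) \<in> \<real>" if "w \<in> \<real>" "norm w < 1" for w
  proof -
    from that(1) obtain x where x: "w = of_real x" by (rule Reals_cases)
    then have "0 < 1 + x" using that by simp
    then show ?thesis using Ln_of_real[of "1 + x"] by (simp add: x)
  qed
  have "norm (cmu ?t / of_nat (j + 1)) < 1" for j
    using norm_div_Suc_le[OF small, of j] by simp
  moreover have "norm ((chain_gf n (exp ?t) - binom_coeff (1 + cmu ?t) n) / binom_coeff (1 + cmu ?t) n) < 1"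
    using norm_ratio_le(1)[OF small, of n] by simp
  ultimately have "?\<Lambda> \<in> \<real>"
    unfolding log_remainder_def
    by (intro Reals_add Reals_mult sum_in_Reals Reals_diff Ln_real Reals_divide P c)
       (auto simp: cmu_of_real)
  then obtain x where x: "?\<Lambda> = of_real x" by (rule Reals_cases)
  have "complex_of_real (exp x) = of_real ((exp t)\<^sup>2 * chain_gf n (exp t))"
    using exp_log_remainder[OF small, of n] unfolding x
    using chain_gf_of_real[of n "exp t"] by (simp add: exp_of_real)
  then have e: "exp x = (exp t)\<^sup>2 * chain_gf n (exp t)" by (simp only: of_real_eq_iff)
  have "x = ln (exp x)" by simp
  also have "\<dots> = 2 * t + ln (chain_gf n (exp t))"
    unfolding e using chain_gf_pos[of "exp t" n] by (simp add: ln_mult ln_realpow)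
  finally show ?thesis using x by simp
qed

text \<open>A family of holomorphic functions that is bounded on a fixed disc has bounded derivatives of every
  order at its centre.\<close>
lemma higher_deriv_log_chain_gf_bound:
  "\<exists>K. \<forall>n. \<bar>(deriv ^^ r) (\<lambda>t. 2 * t + ln (chain_gf n (exp t))) 0 - harm n * (deriv ^^ r) \<mu> 0\<bar> \<le> K"
proof -
  obtain \<rho> where \<rho>: "0 < \<rho>" "cmu holomorphic_on ball 0 \<rho>" "\<And>t. t \<in> ball 0 \<rho> \<Longrightarrow> norm (cmu t) \<le> 1 / 4"
    using cmu_small_ball by blast
  have "\<bar>(deriv ^^ r) (\<lambda>t. 2 * t + ln (chain_gf n (exp t))) 0 - harm n * (deriv ^^ r) \<mu> 0\<bar>
      \<le> fact r * (2 * \<rho> + 2) / (\<rho> / 2) ^ r" for n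
  proof -
    have hol: "log_remainder n holomorphic_on ball 0 \<rho>" by (rule holomorphic_log_remainder[OF \<rho>(2,3)])
    have "complex_of_real ((deriv ^^ r) (\<lambda>t. 2 * t + ln (chain_gf n (exp t))) 0)
       = (deriv ^^ r) (\<lambda>t. of_real (harm n) * cmu t + log_remainder n t) 0"
    proof -
      have "(\<lambda>t. of_real (harm n) * cmu t + log_remainder n t) holomorphic_on ball 0 \<rho>"
        using \<rho>(2) hol by (intro holomorphic_intros)
      from higher_deriv_of_real[OF this log_remainder_of_real[OF \<rho>(3)], where t = 0 and r = r]
      show ?thesis using \<rho>(1) by simp
    qed
    also have "\<dots> = of_real (harm n) * (deriv ^^ r) cmu 0 + (deriv ^^ r) (log_remainder n) 0"
      using \<rho> hol by (subst higher_deriv_add[of _ "ball 0 \<rho>"])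
        (auto intro!: holomorphic_intros simp: higher_deriv_cmult[of _ "ball 0 \<rho>"])
    also have "(deriv ^^ r) cmu 0 = of_real ((deriv ^^ r) \<mu> 0)"
      using higher_deriv_of_real[OF \<rho>(2) cmu_of_real, where t = 0 and r = r] \<rho>(1) by simp
    finally have "complex_of_real ((deriv ^^ r) (\<lambda>t. 2 * t + ln (chain_gf n (exp t))) 0 - harm n * (deriv ^^ r) \<mu> 0)
      = (deriv ^^ r) (log_remainder n) 0" by simp
    moreover have "norm ((deriv ^^ r) (log_remainder n) 0) \<le> fact r * (2 * \<rho> + 2) / (\<rho> / 2) ^ r"
    \<comment> \<open>The radius is halved so that the closed disc lies in the domain of holomorphy.\<close>
    proof (rule Cauchy_inequality)
      show "log_remainder n holomorphic_on ball 0 (\<rho> / 2)"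
        using \<rho>(1) by (intro holomorphic_on_subset[OF hol]) auto
      show "continuous_on (cball 0 (\<rho> / 2)) (log_remainder n)"
        using \<rho>(1) by (intro holomorphic_on_imp_continuous_on holomorphic_on_subset[OF hol]) auto
      show "0 < \<rho> / 2" using \<rho>(1) by simp
      fix t :: complex assume "norm (0 - t) = \<rho> / 2"
      then show "norm (log_remainder n t) \<le> 2 * \<rho> + 2"
        using norm_log_remainder_le[OF \<rho>(3), of t n] \<rho>(1) by simp
    qed
    ultimately show ?thesis by (metis norm_of_real real_norm_def)
  qed
  then show ?thesis by blast
qed

section \<open>Derivatives of the exponent at the origin\<close>

text \<open>The functions that are integer polynomials in \<open>exp\<close>, generated in a way that suits differentiation.\<close>
inductive_set int_exp :: "(real \<Rightarrow> real) set" where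
  const: "(\<lambda>_. of_int k) \<in> int_exp"
| exp: "exp \<in> int_exp"
| add: "f \<in> int_exp \<Longrightarrow> g \<in> int_exp \<Longrightarrow> (\<lambda>t. f t + g t) \<in> int_exp"
| mult: "f \<in> int_exp \<Longrightarrow> g \<in> int_exp \<Longrightarrow> (\<lambda>t. f t * g t) \<in> int_exp"

lemma int_exp_deriv:
  assumes "f \<in> int_exp"
  shows "\<exists>g\<in>int_exp. \<forall>t. (f has_real_derivative g t) (at t)"
  using assms
proof induction
  case (const k)
  show ?case using int_exp.const[of 0] by (intro bexI[of _ "\<lambda>_. 0"]) auto
next
  case exp
  show ?case using int_exp.exp by (intro bexI[of _ exp]) auto
next
  case (add f g)
  then obtain f' g' where "f' \<in> int_exp" "\<And>t. (f has_real_derivative f' t) (at t)"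
    "g' \<in> int_exp" "\<And>t. (g has_real_derivative g' t) (at t)" by blast
  then show ?case by (intro bexI[of _ "\<lambda>t. f' t + g' t"]) (auto intro!: DERIV_add int_exp.add)
next
  case (mult f g)
  then obtain f' g' where "f' \<in> int_exp" "\<And>t. (f has_real_derivative f' t) (at t)"
    "g' \<in> int_exp" "\<And>t. (g has_real_derivative g' t) (at t)" by blast
  then show ?case using mult.hyps
    by (intro bexI[of _ "\<lambda>t. f' t * g t + g' t * f t"]) (auto intro!: DERIV_mult int_exp.add int_exp.mult)
qed

lemma int_exp_at_0: "f \<in> int_exp \<Longrightarrow> f 0 \<in> \<int>"
  by (induction rule: int_exp.induct) auto

lemma has_derivative_sqrt_8exp:
  "((\<lambda>t. sqrt (8 * exp t + 1)) has_real_derivative 4 * exp t / sqrt (8 * exp t + 1)) (at t)"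
proof -
  have "0 < 8 * exp t + 1" by (simp add: add_pos_pos)
  moreover have "((\<lambda>t. 8 * exp t + 1) has_real_derivative 8 * exp t) (at t)"
    by (rule derivative_eq_intros refl | simp)+
  ultimately have "((\<lambda>t. sqrt (8 * exp t + 1)) has_real_derivative
      inverse (sqrt (8 * exp t + 1)) / 2 * (8 * exp t)) (at t)"
    by (intro DERIV_chain2[OF DERIV_real_sqrt])
  moreover have "inverse (sqrt (8 * exp t + 1)) / 2 * (8 * exp t) = 4 * exp t / sqrt (8 * exp t + 1)"
    unfolding divide_inverse by simp
  ultimately show ?thesis by simp
qed

lemma power_quotient_simplify:
  fixes s :: real
  assumes s: "0 < s"
  shows "(2 * a * s ^ (2 * r + 1) - 2 * b * (c * s ^ (2 * r) * (4 * e / s))) / (s ^ (2 * r + 1) * s ^ (2 * r + 1))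
    = 2 * (a * s\<^sup>2 - 4 * c * e * b) / s ^ (2 * r + 3)"
proof -
  define p where "p = s ^ (2 * r)"
  have p: "0 < p" using s by (simp add: p_def)
  have "2 * a * (p * s) - 2 * b * (c * p * (4 * e / s)) = 2 * (a * s\<^sup>2 - 4 * c * e * b) * (p / s)"
    using s by (simp add: field_simps power2_eq_square)
  moreover have "p / s / (p * s * (p * s)) = 1 / (p * s ^ 3)"
    using s p by (simp add: field_simps power3_eq_cube)
  ultimately have "(2 * a * (p * s) - 2 * b * (c * p * (4 * e / s))) / (p * s * (p * s))
     = 2 * (a * s\<^sup>2 - 4 * c * e * b) / (p * s ^ 3)"
    by (metis times_divide_eq_right mult.right_neutral)
  then show ?thesis by (simp only: power_add power_one_right p_def[symmetric])
qed

text \<open>Apart from the factor \<open>2\<close>, the numerator is congruent to \<open>exp\<close> modulo \<open>4\<close>: differentiating the square root produces a factor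
  \<open>4\<close>, and \<open>8 * exp t + 1\<close> is congruent to \<open>1\<close>.\<close>
lemma higher_deriv_mu:
  "\<exists>R\<in>int_exp. \<forall>t. (deriv ^^ Suc r) \<mu> t = 2 * (exp t + 4 * R t) / sqrt (8 * exp t + 1) ^ (2 * r + 1)"
proof (induction r)
  case 0
  have "(\<mu> has_real_derivative 2 * exp t / sqrt (8 * exp t + 1)) (at t)" for t
    unfolding \<mu>_def by (rule derivative_eq_intros has_derivative_sqrt_8exp refl | simp)+
  then have "deriv \<mu> t = 2 * exp t / sqrt (8 * exp t + 1)" for t by (rule DERIV_imp_deriv)
  then show ?case using int_exp.const[of 0] by (intro bexI[of _ "\<lambda>_. 0"]) auto
next
  case (Suc r)
  then obtain R where R: "R \<in> int_exp"
    "\<And>t. (deriv ^^ Suc r) \<mu> t = 2 * (exp t + 4 * R t) / sqrt (8 * exp t + 1) ^ (2 * r + 1)" by blast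
  obtain R' where R': "R' \<in> int_exp" "\<And>t. (R has_real_derivative R' t) (at t)"
    using int_exp_deriv[OF R(1)] by blast
  define Q where "Q t = of_int 2 * (exp t * exp t) + R' t * (of_int 8 * exp t + of_int 1)
      + of_int (- (2 * int r + 1)) * (exp t * (exp t + of_int 4 * R t))" for t
  have Q: "Q \<in> int_exp"
    unfolding Q_def by (intro int_exp.intros R(1) R'(1))
  have fun_eq: "(deriv ^^ Suc r) \<mu> = (\<lambda>t. 2 * (exp t + 4 * R t) / sqrt (8 * exp t + 1) ^ (2 * r + 1))"
    using R(2) by (intro ext)
  have "(deriv ^^ Suc (Suc r)) \<mu> t = 2 * (exp t + 4 * Q t) / sqrt (8 * exp t + 1) ^ (2 * Suc r + 1)" for t
  proof -
    define s where "s = sqrt (8 * exp t + 1)"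
    have s: "0 < s" "s\<^sup>2 = 8 * exp t + 1"
      using exp_ge_zero[of t] by (auto simp: s_def add_pos_nonneg)
    have ds: "((\<lambda>t. sqrt (8 * exp t + 1)) has_real_derivative 4 * exp t / s) (at t)"
      unfolding s_def by (rule has_derivative_sqrt_8exp)
    have "((\<lambda>t. 2 * (exp t + 4 * R t) / sqrt (8 * exp t + 1) ^ (2 * r + 1)) has_real_derivative
      (2 * (exp t + 4 * R' t) * s ^ (2 * r + 1)
        - 2 * (exp t + 4 * R t) * (real (2 * r + 1) * s ^ (2 * r) * (4 * exp t / s))) / (s ^ (2 * r + 1) * s ^ (2 * r + 1))) (at t)"
    proof -
      have num: "((\<lambda>t. 2 * (exp t + 4 * R t)) has_real_derivative 2 * (exp t + 4 * R' t)) (at t)"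
        by (rule derivative_eq_intros R'(2) refl | simp)+
      have den: "((\<lambda>t. sqrt (8 * exp t + 1) ^ (2 * r + 1)) has_real_derivative
          real (2 * r + 1) * s ^ (2 * r) * (4 * exp t / s)) (at t)"
        using DERIV_power[OF ds, of "2 * r + 1"] by (simp add: s_def mult_ac)
      show ?thesis using DERIV_divide[OF num den] s(1) by (simp add: s_def)
    qed
    then have "(deriv ^^ Suc (Suc r)) \<mu> t = (2 * (exp t + 4 * R' t) * s ^ (2 * r + 1)
        - 2 * (exp t + 4 * R t) * (real (2 * r + 1) * s ^ (2 * r) * (4 * exp t / s))) / (s ^ (2 * r + 1) * s ^ (2 * r + 1))"
      unfolding funpow.simps(2)[of "Suc r"] comp_def fun_eq by (rule DERIV_imp_deriv)
    also have "\<dots> = 2 * ((exp t + 4 * R' t) * s\<^sup>2 - 4 * real (2 * r + 1) * exp t * (exp t + 4 * R t)) / s ^ (2 * r + 3)"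
      using s(1) by (rule power_quotient_simplify)
    also have "(exp t + 4 * R' t) * s\<^sup>2 - 4 * real (2 * r + 1) * exp t * (exp t + 4 * R t) = exp t + 4 * Q t"
      unfolding s(2) Q_def by (simp add: algebra_simps)
    finally show ?thesis by (simp add: s_def numeral_3_eq_3)
  qed
  then show ?case using Q by blast
qed

text \<open>At \<open>0\<close> the numerator is twice an integer congruent to \<open>1\<close> modulo \<open>4\<close>, hence not zero. A relative
  error term requires this: if the coefficient of the logarithm vanished, the claim would force the
  cumulant itself to vanish.\<close>
lemma higher_deriv_mu_0_nonzero:
  assumes "1 \<le> r" shows "(deriv ^^ r) \<mu> 0 \<noteq> 0"
proof -
  obtain k where k: "r = Suc k" using assms by (cases r) auto
  obtain R where R: "R \<in> int_exp"
    "(deriv ^^ r) \<mu> 0 = 2 * (exp 0 + 4 * R 0) / sqrt (8 * exp 0 + 1) ^ (2 * k + 1)"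
    using higher_deriv_mu[of k] unfolding k by blast
  obtain i where i: "R 0 = of_int i" using int_exp_at_0[OF R(1)] by (rule Ints_cases)
  have "1 + 4 * i \<noteq> 0" by presburger
  then have "(1 + 4 * R 0) \<noteq> 0" unfolding i by (metis of_int_1 of_int_add of_int_eq_0_iff of_int_mult of_int_numeral)
  then show ?thesis unfolding R(2) by simp
qed

section \<open>Cumulants of the number of vertices\<close>

lemma expectation_exp_f0:
  fixes X :: "nat \<Rightarrow> 'a \<Rightarrow> real \<times> real"
  assumes "prob_space M"
    and indep: "prob_space.indep_vars M (\<lambda>_. borel) X {1..n}"
    and dist: "\<And>i. i \<in> {1..n} \<Longrightarrow> distributed M lborel (X i) (\<lambda>x. indicator T x / measure lborel T)"
    and n: "1 \<le> n"
  shows "(\<integral>\<omega>. exp (t * real (f0 (Tn n X \<omega>))) \<partial>M) = (exp t)\<^sup>2 * chain_gf n (exp t)"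
proof -
  interpret prob_space M by fact
  let ?I = "{1..n}"
  let ?z = "exp t"
  have X_meas: "X i \<in> borel_measurable M" if "i \<in> ?I" for i
    using distributed_measurable[OF dist[OF that]] by simp
  have distr: "distr M borel (X i) = unif_T" if "i \<in> ?I" for i
  proof -
    have "distr M borel (X i) = distr M lborel (X i)" by (rule distr_cong) auto
    also have "\<dots> = unif_T" using distributed_distr_eq_density[OF dist[OF that]] by (simp add: unif_T_def)
    finally show ?thesis .
  qed
  have joint: "distr M (\<Pi>\<^sub>M i\<in>?I. borel) (\<lambda>\<omega>. \<lambda>i\<in>?I. X i \<omega>) = (\<Pi>\<^sub>M i\<in>?I. unif_T)"
  proof -
    have "distr M (\<Pi>\<^sub>M i\<in>?I. borel) (\<lambda>\<omega>. \<lambda>i\<in>?I. X i \<omega>) = (\<Pi>\<^sub>M i\<in>?I. distr M borel (X i))"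
      using indep_vars_iff_distr_eq_PiM'[where I = ?I and M' = "\<lambda>_. borel" and X = X] indep X_meas n
      by simp
    also have "\<dots> = (\<Pi>\<^sub>M i\<in>?I. unif_T)" using distr by (intro PiM_cong) auto
    finally show ?thesis .
  qed
  define W where "W \<omega> = ennreal (?z ^ f0 (convex hull ({v1, v2} \<union> \<omega> ` ?I)))" for \<omega> :: "nat \<Rightarrow> real \<times> real"
  have W_meas: "W \<in> borel_measurable (\<Pi>\<^sub>M i\<in>?I. borel)"
    unfolding W_def by (intro measurable_pow_f0_hull) (auto intro: measurable_component_singleton)
  have rest: "(\<lambda>i\<in>?I. X i \<omega>) ` ?I = (\<lambda>i. X i \<omega>) ` ?I" for \<omega> by auto
  have exp_eq: "exp (t * real (f0 (Tn n X \<omega>))) = ?z ^ f0 (convex hull ({v1, v2} \<union> (\<lambda>i. X i \<omega>) ` ?I))" for \<omega>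
    by (simp add: Tn_def exp_of_nat2_mult)
  have nn: "(\<integral>\<^sup>+\<omega>. ennreal (exp (t * real (f0 (Tn n X \<omega>)))) \<partial>M) = ennreal (?z\<^sup>2 * chain_gf n ?z)"
  proof -
    have "(\<integral>\<^sup>+\<omega>. ennreal (exp (t * real (f0 (Tn n X \<omega>)))) \<partial>M) = (\<integral>\<^sup>+\<omega>. W (\<lambda>i\<in>?I. X i \<omega>) \<partial>M)"
      unfolding exp_eq W_def rest ..
    also have "\<dots> = (\<integral>\<^sup>+\<omega>. W \<omega> \<partial>distr M (\<Pi>\<^sub>M i\<in>?I. borel) (\<lambda>\<omega>. \<lambda>i\<in>?I. X i \<omega>))"
      using X_meas W_meas by (intro nn_integral_distr[symmetric] measurable_restrict) auto
    also have "\<dots> = vertex_pgf ?z ?I" unfolding joint vertex_pgf_def W_def ..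
    also have "\<dots> = ennreal (?z\<^sup>2 * chain_gf n ?z)"
      by (subst vertex_pgf_eq_chain_gf) simp_all
    finally show ?thesis .
  qed
  have meas: "(\<lambda>\<omega>. exp (t * real (f0 (Tn n X \<omega>)))) \<in> borel_measurable M"
    using measurable_f0_hull[OF _ X_meas, of ?I] unfolding Tn_def by simp
  have "(\<integral>\<omega>. exp (t * real (f0 (Tn n X \<omega>))) \<partial>M) = enn2real (\<integral>\<^sup>+\<omega>. ennreal (exp (t * real (f0 (Tn n X \<omega>)))) \<partial>M)"
    using meas by (intro integral_eq_nn_integral) auto
  also have "\<dots> = ?z\<^sup>2 * chain_gf n ?z"
    unfolding nn using chain_gf_pos[of ?z n] by (intro enn2real_ennreal) simp
  finally show ?thesis .
qed

theorem theorem3p1: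
  fixes M :: "nat \<Rightarrow> 'a measure"
    and X :: "nat \<Rightarrow> nat \<Rightarrow> 'a \<Rightarrow> real \<times> real"
    and r :: nat
  assumes "\<And>n. prob_space (M n)"
    and "\<And>n. prob_space.indep_vars (M n) (\<lambda>_. borel) (X n) {1..n}"
    and "\<And>n i. i \<in> {1..n} \<Longrightarrow>
           distributed (M n) lborel (X n i) (\<lambda>x. indicator T x / measure lborel T)"
    and "r \<ge> 1"
  shows "\<exists>\<epsilon> :: nat \<Rightarrow> real. \<epsilon> \<in> o(\<lambda>_. 1) \<and>
           (\<forall>\<^sub>F n in sequentially.
              cumulant (M n) (\<lambda>\<omega>. real (f0 (Tn n (X n) \<omega>))) r
                = (deriv ^^ r) \<mu> 0 * ln (real n) * (1 + \<epsilon> n))"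
proof -
  define D where "D = (deriv ^^ r) \<mu> 0"
  define \<kappa> where "\<kappa> n = cumulant (M n) (\<lambda>\<omega>. real (f0 (Tn n (X n) \<omega>))) r" for n
  define \<epsilon> where "\<epsilon> n = (\<kappa> n - D * ln (real n)) / (D * ln (real n))" for n
  have D: "D \<noteq> 0" unfolding D_def by (rule higher_deriv_mu_0_nonzero[OF assms(4)])
  have \<kappa>_eq: "\<kappa> n = (deriv ^^ r) (\<lambda>t. 2 * t + ln (chain_gf n (exp t))) 0" if "1 \<le> n" for n
  proof -
    have "ln (\<integral>\<omega>. exp (t * real (f0 (Tn n (X n) \<omega>))) \<partial>M n) = 2 * t + ln (chain_gf n (exp t))" for t
    proof -
      have "(\<integral>\<omega>. exp (t * real (f0 (Tn n (X n) \<omega>))) \<partial>M n) = (exp t)\<^sup>2 * chain_gf n (exp t)"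
        by (rule expectation_exp_f0[OF assms(1) assms(2) assms(3) that])
      also have "ln \<dots> = ln ((exp t)\<^sup>2) + ln (chain_gf n (exp t))"
        using chain_gf_pos[of "exp t" n] by (intro ln_mult_pos) simp_all
      also have "ln ((exp t)\<^sup>2) = 2 * t" by (simp add: ln_realpow)
      finally show ?thesis .
    qed
    then show ?thesis by (simp add: \<kappa>_def cumulant_def)
  qed
  obtain K where K: "\<And>n. \<bar>(deriv ^^ r) (\<lambda>t. 2 * t + ln (chain_gf n (exp t))) 0 - harm n * D\<bar> \<le> K"
    using higher_deriv_log_chain_gf_bound[of r] unfolding D_def by blast
  obtain H where H: "\<And>n. \<bar>harm n - ln (real n)\<bar> \<le> H"
    using convergent_imp_Bseq[OF convergentI[OF euler_mascheroni_LIMSEQ]] unfolding Bseq_def by auto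
  have bound: "\<bar>\<kappa> n - D * ln (real n)\<bar> \<le> K + \<bar>D\<bar> * H" if "1 \<le> n" for n
  proof -
    have "\<kappa> n - D * ln (real n) = (\<kappa> n - harm n * D) + D * (harm n - ln (real n))"
      by (simp add: algebra_simps)
    then have "\<bar>\<kappa> n - D * ln (real n)\<bar> \<le> \<bar>\<kappa> n - harm n * D\<bar> + \<bar>D\<bar> * \<bar>harm n - ln (real n)\<bar>"
      by (metis abs_mult abs_triangle_ineq)
    also have "\<dots> \<le> K + \<bar>D\<bar> * H"
      using K[of n] H[of n] \<kappa>_eq[OF that] by (intro add_mono mult_left_mono) auto
    finally show ?thesis .
  qed
  have "\<epsilon> \<longlonglongrightarrow> 0"
  proof (rule Lim_null_comparison)
    show "\<forall>\<^sub>F n in sequentially. norm (\<epsilon> n) \<le> (K + \<bar>D\<bar> * H) / \<bar>D\<bar> * inverse (ln (real n))"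
      using eventually_ge_at_top[of 2]
    proof eventually_elim
      case (elim n)
      then have pos: "0 < ln (real n)" by simp
      have "norm (\<epsilon> n) = \<bar>\<kappa> n - D * ln (real n)\<bar> / (\<bar>D\<bar> * ln (real n))"
        using pos by (simp add: \<epsilon>_def abs_mult)
      also have "\<dots> \<le> (K + \<bar>D\<bar> * H) / (\<bar>D\<bar> * ln (real n))"
        using bound[of n] elim pos by (intro divide_right_mono) auto
      also have "\<dots> = (K + \<bar>D\<bar> * H) / \<bar>D\<bar> * inverse (ln (real n))"
        by (simp only: divide_inverse inverse_mult_distrib mult.assoc)
      finally show ?case .
    qed
    have "filterlim (\<lambda>n. ln (real n)) at_top sequentially"
      by (rule filterlim_compose[OF ln_at_top filterlim_real_sequentially])
    then have "(\<lambda>n. inverse (ln (real n))) \<longlonglongrightarrow> 0"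
      by (rule tendsto_inverse_0_at_top)
    then show "(\<lambda>n. (K + \<bar>D\<bar> * H) / \<bar>D\<bar> * inverse (ln (real n))) \<longlonglongrightarrow> 0"
      by (rule tendsto_mult_right_zero)
  qed
  then have "\<epsilon> \<in> o(\<lambda>_. 1)" by (intro smalloI_tendsto) auto
  moreover have "\<forall>\<^sub>F n in sequentially. \<kappa> n = D * ln (real n) * (1 + \<epsilon> n)"
    using eventually_ge_at_top[of 2]
  proof eventually_elim
    case (elim n)
    then have "0 < ln (real n)" by simp
    then show ?case using D by (simp add: \<epsilon>_def field_simps)
  qed
  ultimately show ?thesis unfolding \<kappa>_def D_def by blast
qed

end
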